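(* Let $J\ge L+1$, let $H_J^{\rm rad}=(\mu^{\rm rad}_{r+s})_{r,s=0}^{J-1}$ be the exact radial Hankel matrix and $\widehat H_J^{\rm rad}=(\widehat\mu^{\rm rad}_{r+s})_{r,s=0}^{J-1}$ the Hankel matrix of the extrapolated radial moments defined in the context, and let $s_*^{\rm rad}=\sigma_L(H_J^{\rm rad})$. For $0<\alpha<1$ set $$\varepsilon^{\rm rad}_{J,\alpha}=\mathcal B_J^{\rm rad}+\sqrt{\mathcal V_J^{\rm rad}/\alpha},$$ where $$\mathcal B_J^{\rm rad}=\Big(\sum_{m=0}^{2J-2}\nu_m\,(b_m^{\rm det})^2\Big)^{1/2},\qquad \mathcal V_J^{\rm rad}=\sum_{m=0}^{2J-2}\nu_m\,v_m^{\rm rad}.$$ There is an event of probability at least $1-\alpha$ on which the following hold. If $$\varepsilon^{\rm rad}_{J,\alpha}<\tfrac12 s_*^{\rm rad},$$ then every absolute threshold $\tau_{\rm abs}$ with $$\varepsilon^{\rm rad}_{J,\alpha}<\tau_{\rm abs}<s_*^{\rm rad}-\varepsilon^{\rm rad}_{J,\alpha}$$ returns exactly $L$ radial interfaces, i.e. exactly $L$ singular values of $\widehat H_J^{\rm rad}$ exceed $\tau_{\rm abs}$. On the same event, irrespective of the size of the signal gap $s_*^{\rm rad}$, $$\sigma_{L+1}(\widehat H_J^{\rm rad})\le\varepsilon^{\rm rad}_{J,\alpha}.$$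
   Context: Exact moments: $L\ge1$, $0<R_1<\cdots<R_L\le R_*$, jumps $\beta_\ell$ with $\gamma_\ell=\beta_\ell R_\ell^2\neq0$, $\xi_\ell=R_\ell^2/R_*^2$, $\mu_m^{\rm rad}=\sum_{\ell=1}^L\gamma_\ell\xi_\ell^m$, and $A_m^{\rm rad}=\sum_{\ell=1}^L|\gamma_\ell|\xi_\ell^m$. Data: $k_1,\dots,k_K>0$ are measured frequencies, at least two of them distinct, $x_\ell=(k_\ell R_* )^2$, $x_{\max}=\max_\ell x_\ell$. For each retained order $0\le m\le 2J-2$ the scaled radial data are $$y_{m\ell}=\mu_m^{\rm rad}+b_mx_\ell+r_{m\ell}+\varepsilon_{m\ell},\qquad b_m=-\frac{\mu^{\rm rad}_{m+1}}{2(m+2)},\qquad \ell=1,\dots,K,$$ where the deterministic remainders satisfy $|r_{m\ell}|\le C_Mx_\ell^2A_{m+2}^{\rm rad}$ with a constant $C_M$ uniform over the retained orders, and the complex random errors $\varepsilon_{m\ell}$ have mean zero, are independent across $\ell$ for each fixed $m$, and have variance $\mathbb{E}|\varepsilon_{m\ell}|^2=\tau_{m\ell}^2>0$. (In the application $y_{m\ell}$ is obtained by scaling $a_{00}(k_\ell)$ for $m=0$ and $\frac12(a_{m,-m}+a_{-m,m})(k_\ell)$ for $m\ge1$ by $g_{m\ell}=\frac{(2m+2)(m!)^2}{2\pi C_{k_\ell}R_*^{2m}}(2/k_\ell)^{2m}$, where $C_k\ne0$ is the far-field normalization and $a_{mn}(k)$ are the noisy two-angle Fourier coefficients of the far field at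 frequency $k$, whose errors are uncorrelated with variance $\sigma_{k}^2$; then $\tau_{m\ell}^2=\chi_m|g_{m\ell}|^2\sigma_{k_\ell}^2$ with $\chi_0=1$, $\chi_m=\frac12$ for $m\ge1$.) Estimator: $X\in\mathbb{R}^{K\times2}$ has rows $(1,x_\ell)$, $\Sigma_m=\operatorname{diag}(\tau_{m1}^2,\dots,\tau_{mK}^2)$, $y_m=(y_{m\ell})_\ell$, $e_1=(1,0)^T$, $w_m^T=e_1^T(X^*\Sigma_m^{-1}X)^{-1}X^*\Sigma_m^{-1}$, $\widehat\mu_m^{\rm rad}=w_m^Ty_m$, $v_m^{\rm rad}=e_1^T(X^*\Sigma_m^{-1}X)^{-1}e_1$, and $b_m^{\rm det}=C_M\|w_m\|_1x_{\max}^2A_{m+2}^{\rm rad}$. Multiplicities: $\nu_m=m+1$ for $0\le m\le J-1$ and $\nu_m=2J-1-m$ for $J\le m\le2J-2$. Singular values are ordered decreasingly, $\sigma_1\ge\sigma_2\ge\cdots$. *)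

theory Defs
  imports "HOL-Probability.Probability" "Jordan_Normal_Form.Schur_Decomposition"
begin

no_notation Finite_Cartesian_Product.vec_nth (infixl "$" 90)
no_notation Inner_Product.real_inner_class.inner (infixl "\<bullet>" 70)

section \<open>Singular values\<close>

text \<open>The decreasing list of the square roots of the eigenvalues of \<open>A\<^sup>* A\<close>, counted with
  algebraic multiplicity. These eigenvalues are real and nonnegative, so \<open>Re\<close> loses nothing.\<close>

definition singular_values :: "complex mat \<Rightarrow> real list" where
  "singular_values A =
     rev (sorted_list_of_multiset
       (image_mset (\<lambda>z. sqrt (Re z)) (proots (char_poly (mat_adjoint A * A)))))"

text \<open>Indices of singular values start at \<open>1\<close>; only \<open>1 \<le> i \<le> dim_col A\<close> is meaningful.\<close>

definition singular_value :: "complex mat \<Rightarrow> nat \<Rightarrow> real" where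
  "singular_value A i = singular_values A ! (i - 1)"

definition hankel_mat :: "nat \<Rightarrow> (nat \<Rightarrow> complex) \<Rightarrow> complex mat" where
  "hankel_mat J \<mu> = Matrix.mat J J (\<lambda>(r, s). \<mu> (r + s))"


section \<open>Exact radial moments\<close>

text \<open>The interfaces are indexed by \<open>0, \<dots>, L - 1\<close>. The jumps are complex, which
  covers real jumps.\<close>

definition rad_gamma :: "(nat \<Rightarrow> complex) \<Rightarrow> (nat \<Rightarrow> real) \<Rightarrow> nat \<Rightarrow> complex" where
  "rad_gamma \<beta> R l = \<beta> l * of_real ((R l)\<^sup>2)"

definition rad_xi :: "(nat \<Rightarrow> real) \<Rightarrow> real \<Rightarrow> nat \<Rightarrow> real" where
  "rad_xi R Rs l = (R l)\<^sup>2 / Rs\<^sup>2"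

definition rad_moment ::
    "nat \<Rightarrow> (nat \<Rightarrow> complex) \<Rightarrow> (nat \<Rightarrow> real) \<Rightarrow> real \<Rightarrow> nat \<Rightarrow> complex" where
  "rad_moment L \<beta> R Rs m = (\<Sum>l<L. rad_gamma \<beta> R l * of_real (rad_xi R Rs l ^ m))"

definition rad_abs_moment ::
    "nat \<Rightarrow> (nat \<Rightarrow> complex) \<Rightarrow> (nat \<Rightarrow> real) \<Rightarrow> real \<Rightarrow> nat \<Rightarrow> real" where
  "rad_abs_moment L \<beta> R Rs m = (\<Sum>l<L. cmod (rad_gamma \<beta> R l) * rad_xi R Rs l ^ m)"

definition rad_slope ::
    "nat \<Rightarrow> (nat \<Rightarrow> complex) \<Rightarrow> (nat \<Rightarrow> real) \<Rightarrow> real \<Rightarrow> nat \<Rightarrow> complex" where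
  "rad_slope L \<beta> R Rs m = - (rad_moment L \<beta> R Rs (m + 1) / (2 * (of_nat m + 2)))"


section \<open>Weighted least-squares extrapolation to zero frequency\<close>

text \<open>The frequencies are indexed by \<open>0, \<dots>, K - 1\<close>. The design matrix is real, so its adjoint
  is its transpose. The argument \<open>\<sigma>2\<close> is the vector of error variances.\<close>

definition scaled_freq :: "real \<Rightarrow> (nat \<Rightarrow> real) \<Rightarrow> nat \<Rightarrow> real" where
  "scaled_freq Rs k l = (k l * Rs)\<^sup>2"

definition design_mat :: "nat \<Rightarrow> (nat \<Rightarrow> real) \<Rightarrow> real mat" where
  "design_mat K x = Matrix.mat K 2 (\<lambda>(l, j). if j = 0 then 1 else x l)"

abbreviation minv :: "real mat \<Rightarrow> real mat" where
  "minv A \<equiv> the (mat_inverse A)"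

definition gls_cov :: "nat \<Rightarrow> (nat \<Rightarrow> real) \<Rightarrow> (nat \<Rightarrow> real) \<Rightarrow> real mat" where
  "gls_cov K x \<sigma>2 =
     minv (transpose_mat (design_mat K x) * minv (mat_diag K \<sigma>2) * design_mat K x)"

text \<open>The column vector \<open>w\<close> with \<open>w\<^sup>T = e\<^sub>1\<^sup>T (X\<^sup>* \<Sigma>\<^sup>-\<^sup>1 X)\<^sup>-\<^sup>1 X\<^sup>* \<Sigma>\<^sup>-\<^sup>1\<close>.\<close>

definition gls_weight :: "nat \<Rightarrow> (nat \<Rightarrow> real) \<Rightarrow> (nat \<Rightarrow> real) \<Rightarrow> real Matrix.vec" where
  "gls_weight K x \<sigma>2 =
     transpose_mat (gls_cov K x \<sigma>2 * transpose_mat (design_mat K x) * minv (mat_diag K \<sigma>2))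
       *\<^sub>v unit_vec 2 0"

definition gls_var :: "nat \<Rightarrow> (nat \<Rightarrow> real) \<Rightarrow> (nat \<Rightarrow> real) \<Rightarrow> real" where
  "gls_var K x \<sigma>2 = unit_vec 2 0 \<bullet> (gls_cov K x \<sigma>2 *\<^sub>v unit_vec 2 0)"

definition gls_estimate ::
    "nat \<Rightarrow> (nat \<Rightarrow> real) \<Rightarrow> (nat \<Rightarrow> real) \<Rightarrow> (nat \<Rightarrow> complex) \<Rightarrow> complex" where
  "gls_estimate K x \<sigma>2 y = (\<Sum>l<K. of_real (gls_weight K x \<sigma>2 $ l) * y l)"

definition det_bias ::
    "nat \<Rightarrow> (nat \<Rightarrow> real) \<Rightarrow> (nat \<Rightarrow> real) \<Rightarrow> real \<Rightarrow> real \<Rightarrow> real" where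
  "det_bias K x \<sigma>2 C A =
     C * (\<Sum>l<K. \<bar>gls_weight K x \<sigma>2 $ l\<bar>) * (Max (x ` {..<K}))\<^sup>2 * A"


section \<open>Error level of the Hankel matrix\<close>

text \<open>For \<open>m \<le> 2 * J - 2\<close>, the number of entries \<open>(r, s)\<close> of a \<open>J\<close> by \<open>J\<close>
  matrix with \<open>r + s = m\<close>.\<close>

definition hankel_mult :: "nat \<Rightarrow> nat \<Rightarrow> nat" where
  "hankel_mult J m = (if m \<le> J - 1 then m + 1 else 2 * J - 1 - m)"

text \<open>The arguments \<open>b\<close> and \<open>v\<close> are the deterministic biases and the variances of the moments.\<close>

definition hankel_error_level :: "nat \<Rightarrow> (nat \<Rightarrow> real) \<Rightarrow> (nat \<Rightarrow> real) \<Rightarrow> real \<Rightarrow> real" where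
  "hankel_error_level J b v \<alpha> =
     sqrt (\<Sum>m\<le>2 * J - 2. real (hankel_mult J m) * (b m)\<^sup>2)
     + sqrt ((\<Sum>m\<le>2 * J - 2. real (hankel_mult J m) * v m) / \<alpha>)"

end

theory Submission
  imports Defs
begin

text \<open>The exact radial moments are power sums with \<open>L\<close> nodes, so their Hankel matrix has a Vandermonde
  factorization through dimension \<open>L\<close> and its singular values vanish after the first \<open>L\<close>
  (\<open>hankel_factorization\<close>, \<open>singular_value_zero_of_factorization\<close>). By Weyl's inequality
  (\<open>weyl_singular_values\<close>) no singular value of the estimated Hankel matrix differs from the exact
  one by more than the Frobenius norm of the error. If that norm is at most \<open>e\<close>, then the singular
  values after the first \<open>L\<close> are at most \<open>e\<close>, the first \<open>L\<close> are at least \<open>\<sigma>\<^sub>L - e\<close>, and any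
  threshold strictly between the two bounds counts exactly \<open>L\<close> (\<open>hankel_rank_detection\<close>).

  It remains to bound the Frobenius norm with probability \<open>1 - \<alpha>\<close>. The least-squares weights
  reproduce constants and annihilate the linear term in \<open>x\<close> (\<open>gls_unbiased\<close>), so the error of a
  moment is a weighted sum of the deterministic remainders, bounded by \<open>det_bias\<close>, plus the same
  weighted sum \<open>\<eta>\<close> of the random errors, whose second moment is \<open>gls_var\<close> (\<open>gls_var_eq\<close>,
  \<open>variance_weighted_sum\<close>). In the Frobenius norm the moment of order \<open>m\<close> is counted once for every
  entry of its antidiagonal. Minkowski's inequality splits off the bias (\<open>hankel_error_bound\<close>), and
  Markov's inequality for the weighted sum of the \<open>\<bar>\<eta>\<^sub>m\<bar>\<^sup>2\<close> gives the event.

  Weyl's inequality is derived from a unitary diagonalization of \<open>A\<^sup>* A\<close>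
  (\<open>hermitian_diagonalization\<close>) and the dimension count behind the Courant-Fischer principle
  (\<open>singular_value_le_on_kernel\<close>).\<close>

section \<open>The adjoint of a complex matrix\<close>

lemma mat_adjoint_dim [simp]:
  "dim_row (mat_adjoint A) = dim_col A" "dim_col (mat_adjoint A) = dim_row A"
  unfolding mat_adjoint_def by simp_all

lemma mat_adjoint_carrier [simp]:
  "A \<in> carrier_mat n m \<Longrightarrow> mat_adjoint A \<in> carrier_mat m n"
  by (rule carrier_matI) auto

lemma mat_adjoint_index [simp]:
  "i < dim_col A \<Longrightarrow> j < dim_row A \<Longrightarrow> mat_adjoint A $$ (i, j) = conjugate (A $$ (j, i))"
  unfolding mat_adjoint_def by (simp add: mat_of_rows_def)

lemma mat_adjoint_adjoint [simp]:
  "mat_adjoint (mat_adjoint (A :: complex mat)) = A"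
  by (rule eq_matI) auto

lemma mat_adjoint_mult:
  fixes A B :: "complex mat"
  assumes "A \<in> carrier_mat n m" "B \<in> carrier_mat m p"
  shows "mat_adjoint (A * B) = mat_adjoint B * mat_adjoint A"
  using assms
  by (intro eq_matI) (auto simp: scalar_prod_def conjugate_complex_def mult.commute intro!: sum.cong)

lemma mat_adjoint_mult_index:
  fixes A B :: "complex mat"
  assumes "i < dim_col A" "j < dim_col B" "dim_row A = dim_row B"
  shows "(mat_adjoint A * B) $$ (i, j) = (\<Sum>k = 0..<dim_row B. cnj (A $$ (k, i)) * B $$ (k, j))"
  using assms by (auto simp: scalar_prod_def conjugate_complex_def intro!: sum.cong)

section \<open>Unitary diagonalization of Hermitian matrices\<close>

text \<open>Complete \<open>v\<close> to a basis and orthogonalize it. The process keeps its first vector and yields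
  vectors of arbitrary length; normalizing them rescales \<open>v\<close>.\<close>

lemma unitary_with_first_column:
  fixes v :: "complex Matrix.vec"
  assumes v: "v \<in> carrier_vec n" and v0: "v \<noteq> 0\<^sub>v n"
  obtains U c where "U \<in> carrier_mat n n" "mat_adjoint U * U = 1\<^sub>m n" "col U 0 = c \<cdot>\<^sub>v v"
proof -
  interpret cof_vec_space n "TYPE(complex)" .
  define b where "b = basis_completion v"
  define ws where "ws = gram_schmidt n b"
  from basis_completion[OF v v0, folded b_def]
  have dist_b: "distinct b" and indep: "\<not> lin_dep (set b)" and b: "set b \<subseteq> carrier_vec n"
    and hdb: "hd b = v" and len_b: "length b = n" by auto
  have n: "n > 0"
    using v v0 by (metis carrier_vecD eq_vecI gr0I index_zero_vec(2) less_nat_zero_code)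
  from hdb len_b n obtain vs where bv: "b = v # vs" by (cases b) auto
  from gram_schmidt_result[OF b dist_b indep refl, folded ws_def]
  have ws: "set ws \<subseteq> carrier_vec n" "corthogonal ws" "length ws = n"
    by (auto simp: len_b)
  from gram_schmidt_hd[OF v, of vs, folded bv] have "hd ws = v" unfolding ws_def .
  then have ws0: "ws ! 0 = v" using ws(3) n by (metis hd_conv_nth length_greater_0_conv)
  have wsc: "ws ! j \<in> carrier_vec n" if "j < n" for j
    using ws that by auto
  define N where "N j = sqrt (\<Sum>i = 0..<n. (cmod (ws ! j $ i))\<^sup>2)" for j
  have sp: "ws ! j \<bullet>c ws ! i = (\<Sum>k = 0..<n. ws ! j $ k * cnj (ws ! i $ k))"
    if "i < n" "j < n" for i j
    using wsc[OF that(1)] wsc[OF that(2)]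
    by (auto simp: scalar_prod_def conjugate_complex_def intro!: sum.cong)
  have NN: "complex_of_real (N j * N j) = ws ! j \<bullet>c ws ! j" if "j < n" for j
    unfolding sp[OF that that] N_def
    by (simp add: sum_nonneg complex_norm_square del: of_real_power)
  have N0: "N j \<noteq> 0" if "j < n" for j
    using corthogonalD[OF ws(2), of j j] NN[OF that] that ws(3) by auto
  define U where "U = Matrix.mat n n (\<lambda>(i, j). ws ! j $ i / complex_of_real (N j))"
  have U: "U \<in> carrier_mat n n" unfolding U_def by simp
  have "mat_adjoint U * U = 1\<^sub>m n"
  proof (rule eq_matI)
    fix i j assume ij: "i < dim_row (1\<^sub>m n :: complex mat)" "j < dim_col (1\<^sub>m n :: complex mat)"
    then have "(mat_adjoint U * U) $$ (i, j)
        = (\<Sum>k = 0..<n. cnj (ws ! i $ k / of_real (N i)) * (ws ! j $ k / of_real (N j)))"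
      by (subst mat_adjoint_mult_index) (auto simp: U_def intro!: sum.cong)
    also have "\<dots> = (ws ! j \<bullet>c ws ! i) / (of_real (N i) * of_real (N j))"
      using ij by (simp add: sp sum_divide_distrib mult.commute)
    also have "\<dots> = 1\<^sub>m n $$ (i, j)"
      using ij corthogonalD[OF ws(2), of j i] NN[of i] N0[of i] ws(3) by auto
    finally show "(mat_adjoint U * U) $$ (i, j) = 1\<^sub>m n $$ (i, j)" .
  qed (use U in auto)
  moreover have "col U 0 = (1 / of_real (N 0)) \<cdot>\<^sub>v v"
    using n v ws0 by (intro eq_vecI) (auto simp: U_def)
  ultimately show thesis using that U by blast
qed

text \<open>Deflation: conjugating with a unitary matrix whose first column is an eigenvector for \<open>e\<close> clears
  the rest of the first column, hence, the matrix being Hermitian, also the rest of the first row.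
  The remaining block is Hermitian, and its characteristic polynomial has lost exactly the factor
  of \<open>e\<close>. The roots may be listed in any order, so the diagonal can later be arranged
  decreasingly, and each root occurs with its algebraic multiplicity, which is what
  \<open>singular_values\<close> counts.\<close>

lemma hermitian_diagonalization:
  fixes A :: "complex mat"
  assumes "A \<in> carrier_mat n n" "mat_adjoint A = A" "char_poly A = (\<Prod>e\<leftarrow>es. [:- e, 1:])"
  obtains U where "U \<in> carrier_mat n n" "mat_adjoint U * U = 1\<^sub>m n"
    "mat_adjoint U * A * U = mat_diag n (\<lambda>i. es ! i)"
  using assms
proof (induction es arbitrary: n A thesis)
  case Nil
  have "n = 0" using degree_monic_char_poly[OF Nil(2)] Nil(4) by simp
  then show ?case
    using Nil(2) by (intro Nil(1)[of "1\<^sub>m 0"]) (auto simp: mat_diag_def intro!: eq_matI)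
next
  case (Cons e es)
  note A = Cons.prems(2)
  have "degree (\<Prod>e\<leftarrow>e # es. [:- e, 1:]) = Suc (length es)"
    using degree_linear_factors[of uminus "e # es"] by simp
  then have "n = Suc (length es)"
    using degree_monic_char_poly[OF A] Cons.prems(4) by simp
  then obtain k where n: "n = Suc k" by blast
  have "eigenvalue A e"
    unfolding eigenvalue_root_char_poly[OF A] Cons.prems(4) by simp
  from find_eigenvector[OF A this] obtain v where
    v: "v \<in> carrier_vec n" "v \<noteq> 0\<^sub>v n" and ev: "A *\<^sub>v v = e \<cdot>\<^sub>v v"
    using A unfolding eigenvector_def by auto
  obtain U c where U: "U \<in> carrier_mat n n" and UU: "mat_adjoint U * U = 1\<^sub>m n"
    and col0: "col U 0 = c \<cdot>\<^sub>v v"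
    using unitary_with_first_column[OF v] .
  note Uc = mat_adjoint_carrier[OF U]
  have UU': "U * mat_adjoint U = 1\<^sub>m n"
    using mat_mult_left_right_inverse[OF Uc U UU] .
  define B where "B = mat_adjoint U * A * U"
  have B: "B \<in> carrier_mat n n" unfolding B_def using A U Uc by auto
  have Bh: "mat_adjoint B = B"
  proof -
    have "mat_adjoint B = mat_adjoint U * (mat_adjoint A * U)"
      unfolding B_def mat_adjoint_mult[OF mult_carrier_mat[OF Uc A] U] mat_adjoint_mult[OF Uc A]
      by simp
    then show ?thesis
      unfolding B_def Cons.prems(3) assoc_mult_mat[OF Uc A U] .
  qed
  have AU0: "col (A * U) 0 = e \<cdot>\<^sub>v col U 0"
  proof -
    have "col (A * U) 0 = A *\<^sub>v col U 0" by (rule col_mult2[OF A U]) (simp add: n)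
    also have "\<dots> = c \<cdot>\<^sub>v (A *\<^sub>v v)" unfolding col0 by (rule mult_mat_vec[OF A v(1)])
    also have "\<dots> = e \<cdot>\<^sub>v col U 0"
      unfolding ev col0 by (simp only: smult_smult_assoc mult.commute[of c e])
    finally show ?thesis .
  qed
  have B0: "B $$ (i, 0) = (if i = 0 then e else 0)" if i: "i < n" for i
  proof -
    have dims: "i < dim_row (mat_adjoint U)" "0 < dim_col U" "0 < dim_col (A * U)"
      using i n U A by auto
    have "B = mat_adjoint U * (A * U)" unfolding B_def by (rule assoc_mult_mat[OF Uc A U])
    then have "B $$ (i, 0) = Matrix.row (mat_adjoint U) i \<bullet> (e \<cdot>\<^sub>v col U 0)"
      unfolding AU0[symmetric] using dims by (simp only: index_mult_mat(1))
    also have "\<dots> = e * (Matrix.row (mat_adjoint U) i \<bullet> col U 0)"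
      by (rule scalar_prod_smult_distrib[OF row_carrier_vec[OF i Uc] col_carrier_vec[OF _ U]]) (simp add: n)
    also have "\<dots> = e * (mat_adjoint U * U) $$ (i, 0)"
      using dims by (simp only: index_mult_mat(1))
    finally show ?thesis unfolding UU using i n by simp
  qed
  have B0': "B $$ (0, j) = (if j = 0 then e else 0)" if j: "j < n" for j
  proof -
    have "B $$ (0, j) = conjugate (B $$ (j, 0))"
      using mat_adjoint_index[of 0 B j] B j n unfolding Bh by auto
    then show ?thesis using B0[of j] B0[of 0] j n by (cases "j = 0") simp_all
  qed
  define C where "C = Matrix.mat k k (\<lambda>(i, j). B $$ (Suc i, Suc j))"
  have C: "C \<in> carrier_mat k k" unfolding C_def by simp
  have Ch: "mat_adjoint C = C"
  proof (rule eq_matI)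
    fix i j assume "i < dim_row C" "j < dim_col C"
    then show "mat_adjoint C $$ (i, j) = C $$ (i, j)"
      using mat_adjoint_index[of "Suc i" B "Suc j"] B n unfolding Bh by (auto simp: C_def)
  qed (auto simp: C_def)
  define E where "E = Matrix.mat 1 1 (\<lambda>_. e)"
  have E: "E \<in> carrier_mat 1 1" unfolding E_def by simp
  have Bblock: "B = four_block_mat E (0\<^sub>m 1 k) (0\<^sub>m k 1) C"
  proof (rule eq_matI)
    fix i j assume "i < dim_row (four_block_mat E (0\<^sub>m 1 k) (0\<^sub>m k 1) C)"
      "j < dim_col (four_block_mat E (0\<^sub>m 1 k) (0\<^sub>m k 1) C)"
    then have "i < n" "j < n" using n by (auto simp: E_def C_def)
    then show "B $$ (i, j) = four_block_mat E (0\<^sub>m 1 k) (0\<^sub>m k 1) C $$ (i, j)"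
      using B0[of i] B0'[of j] n by (cases i; cases j) (auto simp: E_def C_def)
  qed (use B n in \<open>auto simp: E_def C_def\<close>)
  have "similar_mat_wit B A (mat_adjoint U) U"
    by (rule similar_mat_witI[of _ _ n]) (use U Uc UU UU' A B in \<open>auto simp: B_def\<close>)
  then have "char_poly B = char_poly A"
    by (intro char_poly_similar) (auto simp: similar_mat_def)
  moreover have "char_poly B = char_poly E * char_poly C"
    unfolding Bblock by (rule char_poly_four_block_zeros_col[OF E _ C]) simp
  moreover have "char_poly E = [:- e, 1:]"
    by (simp add: E_def char_poly_defs Determinant.det_def sign_def)
  ultimately have "[:- e, 1:] * char_poly C = [:- e, 1:] * (\<Prod>e\<leftarrow>es. [:- e, 1:])"
    using Cons.prems(4) by simp
  then have "char_poly C = (\<Prod>e\<leftarrow>es. [:- e, 1:])"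
    by (metis mult_cancel_left pCons_eq_0_iff zero_neq_one)
  from Cons.IH[OF _ C Ch this] obtain V where V: "V \<in> carrier_mat k k"
    and VV: "mat_adjoint V * V = 1\<^sub>m k"
    and Vd: "mat_adjoint V * C * V = mat_diag k (\<lambda>i. es ! i)" by blast
  note Vc = mat_adjoint_carrier[OF V]
  define W where "W = four_block_mat (1\<^sub>m 1) (0\<^sub>m 1 k) (0\<^sub>m k 1) V"
  have W: "W \<in> carrier_mat n n" unfolding W_def using V n by auto
  note Wc = mat_adjoint_carrier[OF W]
  have Wa: "mat_adjoint W = four_block_mat (1\<^sub>m 1) (0\<^sub>m 1 k) (0\<^sub>m k 1) (mat_adjoint V)"
    unfolding W_def using V by (intro eq_matI) auto
  have WW: "mat_adjoint W * W = 1\<^sub>m n"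
    unfolding Wa unfolding W_def using V Vc VV n
    by (subst mult_four_block_mat[of _ 1 1 _ k _ k _ _ 1 _ k]) auto
  have WBW: "mat_adjoint W * B * W = four_block_mat E (0\<^sub>m 1 k) (0\<^sub>m k 1) (mat_adjoint V * C * V)"
  proof -
    have "mat_adjoint W * B = four_block_mat E (0\<^sub>m 1 k) (0\<^sub>m k 1) (mat_adjoint V * C)"
      unfolding Wa Bblock using V Vc C E
      by (subst mult_four_block_mat[of _ 1 1 _ k _ k _ _ 1 _ k]) auto
    then show ?thesis
      unfolding W_def using V Vc C E mult_carrier_mat[OF Vc C]
      by (simp, subst mult_four_block_mat[of _ 1 1 _ k _ k _ _ 1 _ k]) auto
  qed
  have WBW': "mat_adjoint W * B * W = mat_diag n (\<lambda>i. (e # es) ! i)"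
    unfolding WBW Vd
    by (rule eq_matI) (auto simp: n E_def mat_diag_def nth_Cons split: nat.splits)
  show ?case
  proof (rule Cons.prems(1)[of "U * W"])
    show "U * W \<in> carrier_mat n n" using U W by auto
    have ad: "mat_adjoint (U * W) = mat_adjoint W * mat_adjoint U"
      using U W by (rule mat_adjoint_mult)
    have "mat_adjoint (U * W) * (U * W) = mat_adjoint W * (mat_adjoint U * U * W)"
      unfolding ad assoc_mult_mat[OF Wc Uc mult_carrier_mat[OF U W]] assoc_mult_mat[OF Uc U W] ..
    then show "mat_adjoint (U * W) * (U * W) = 1\<^sub>m n"
      unfolding UU using W WW by simp
    have "mat_adjoint W * B = mat_adjoint (U * W) * A * U"
      unfolding ad B_def assoc_mult_mat[OF Wc mult_carrier_mat[OF Uc A] U, symmetric]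
        assoc_mult_mat[OF Wc Uc A, symmetric] ..
    then have "mat_adjoint (U * W) * A * (U * W) = mat_adjoint W * B * W"
      using assoc_mult_mat[OF mult_carrier_mat[OF mult_carrier_mat[OF Wc Uc] A] U W]
      by (simp only: ad)
    then show "mat_adjoint (U * W) * A * (U * W) = mat_diag n (\<lambda>i. (e # es) ! i)"
      using WBW' by simp
  qed
qed

section \<open>Norms\<close>

text \<open>The Euclidean norm and the Frobenius norm are both given by \<open>L2_set\<close>, whose triangle and
  Cauchy-Schwarz inequalities then apply to matrices of any dimension.\<close>

definition vec_norm2 :: "complex Matrix.vec \<Rightarrow> real" where
  "vec_norm2 x = L2_set (\<lambda>i. cmod (x $ i)) {0..<dim_vec x}"

definition frobenius_norm :: "complex mat \<Rightarrow> real" where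
  "frobenius_norm A = L2_set (\<lambda>(i, j). cmod (A $$ (i, j))) ({0..<dim_row A} \<times> {0..<dim_col A})"

lemma vec_norm2_nonneg [simp]: "0 \<le> vec_norm2 x"
  by (simp add: vec_norm2_def)

lemma vec_norm2_add:
  assumes "x \<in> carrier_vec n" "y \<in> carrier_vec n"
  shows "vec_norm2 (x + y) \<le> vec_norm2 x + vec_norm2 y"
proof -
  have "vec_norm2 (x + y) \<le> L2_set (\<lambda>i. cmod (x $ i) + cmod (y $ i)) {0..<n}"
    unfolding vec_norm2_def using assms
    by (auto intro!: L2_set_mono norm_triangle_ineq)
  also have "\<dots> \<le> vec_norm2 x + vec_norm2 y"
    unfolding vec_norm2_def using assms L2_set_triangle_ineq by auto
  finally show ?thesis .
qed

lemma vec_norm2_mult_mat_vec_le: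
  assumes A: "A \<in> carrier_mat m n" and x: "x \<in> carrier_vec n"
  shows "vec_norm2 (A *\<^sub>v x) \<le> frobenius_norm A * vec_norm2 x"
proof -
  have "cmod ((A *\<^sub>v x) $ i) \<le> L2_set (\<lambda>j. cmod (A $$ (i, j))) {0..<n} * vec_norm2 x"
    if i: "i < m" for i
  proof -
    have "cmod ((A *\<^sub>v x) $ i) \<le> (\<Sum>j = 0..<n. \<bar>cmod (A $$ (i, j))\<bar> * \<bar>cmod (x $ j)\<bar>)"
      using A x i by (auto simp: scalar_prod_def norm_mult intro!: sum_norm_le)
    also have "\<dots> \<le> L2_set (\<lambda>j. cmod (A $$ (i, j))) {0..<n} * L2_set (\<lambda>j. cmod (x $ j)) {0..<n}"
      by (rule L2_set_mult_ineq)
    finally show ?thesis using x by (simp add: vec_norm2_def)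
  qed
  then have "vec_norm2 (A *\<^sub>v x)
      \<le> L2_set (\<lambda>i. L2_set (\<lambda>j. cmod (A $$ (i, j))) {0..<n} * vec_norm2 x) {0..<m}"
    unfolding vec_norm2_def[of "A *\<^sub>v x"] using A by (auto intro!: L2_set_mono)
  also have "\<dots> = L2_set (\<lambda>i. L2_set (\<lambda>j. cmod (A $$ (i, j))) {0..<n}) {0..<m} * vec_norm2 x"
    by (simp add: L2_set_left_distrib)
  also have "L2_set (\<lambda>i. L2_set (\<lambda>j. cmod (A $$ (i, j))) {0..<n}) {0..<m} = frobenius_norm A"
    using A by (simp add: frobenius_norm_def L2_set_def sum_nonneg sum.cartesian_product case_prod_unfold)
  finally show ?thesis .
qed

text \<open>Pythagoras. It serves twice: for a unitary matrix (\<open>d = 1\<close>) it says that coordinates keep the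
  norm, and for \<open>A * U\<close> with \<open>U\<close> a basis of right singular vectors of \<open>A\<close> it writes the norm of
  \<open>A x\<close> in those coordinates.\<close>

lemma vec_norm2_orthogonal_columns:
  fixes B :: "complex mat"
  assumes B: "B \<in> carrier_mat m n" and c: "c \<in> carrier_vec n"
    and BB: "mat_adjoint B * B = mat_diag n (\<lambda>i. complex_of_real (d i))"
  shows "(vec_norm2 (B *\<^sub>v c))\<^sup>2 = (\<Sum>i = 0..<n. d i * (cmod (c $ i))\<^sup>2)"
proof -
  have e: "(\<Sum>k = 0..<m. cnj (B $$ (k, i)) * B $$ (k, j)) = (if i = j then of_real (d j) else 0)"
    if "i < n" "j < n" for i j
  proof -
    have "(mat_adjoint B * B) $$ (i, j) = (\<Sum>k = 0..<m. cnj (B $$ (k, i)) * B $$ (k, j))"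
      using B that by (subst mat_adjoint_mult_index) auto
    then show ?thesis unfolding BB using that by (simp add: mat_diag_def)
  qed
  have "complex_of_real ((vec_norm2 (B *\<^sub>v c))\<^sup>2) =
     (\<Sum>k = 0..<m. (\<Sum>j = 0..<n. B $$ (k, j) * c $ j) * cnj (\<Sum>i = 0..<n. B $$ (k, i) * c $ i))"
    using B c by (auto simp: vec_norm2_def L2_set_def sum_nonneg complex_norm_square scalar_prod_def
        simp del: of_real_power cnj_sum intro!: sum.cong)
  also have "\<dots> = (\<Sum>k = 0..<m. \<Sum>j = 0..<n. \<Sum>i = 0..<n.
      c $ j * cnj (c $ i) * (cnj (B $$ (k, i)) * B $$ (k, j)))"
    by (simp add: sum_product mult_ac)
  also have "\<dots> = (\<Sum>j = 0..<n. \<Sum>i = 0..<n.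
      c $ j * cnj (c $ i) * (\<Sum>k = 0..<m. cnj (B $$ (k, i)) * B $$ (k, j)))"
    unfolding sum_distrib_left
    by (subst sum.swap, rule sum.cong[OF refl], rule sum.swap)
  also have "\<dots> = (\<Sum>j = 0..<n. \<Sum>i = 0..<n. if i = j then c $ j * cnj (c $ i) * of_real (d j) else 0)"
    by (intro sum.cong refl) (auto simp: e)
  also have "\<dots> = complex_of_real (\<Sum>j = 0..<n. d j * (cmod (c $ j))\<^sup>2)"
    by (auto simp: complex_norm_square mult_ac simp del: of_real_power intro!: sum.cong)
  finally show ?thesis by (simp only: of_real_eq_iff)
qed

section \<open>Singular values\<close>

text \<open>Diagonalize \<open>A\<^sup>* A\<close> with its eigenvalues in decreasing order. The \<open>i\<close>-th eigenvalue is the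
  squared norm of the \<open>i\<close>-th column of \<open>A U\<close>, hence real and nonnegative; so it is the square of
  its own square root, which is entry \<open>i\<close> of \<open>singular_values A\<close>.\<close>

lemma
  assumes A: "A \<in> carrier_mat n n"
  shows singular_values_sorted: "sorted_wrt (\<ge>) (singular_values A)"
    and length_singular_values: "length (singular_values A) = n"
    and singular_values_nonneg: "i < n \<Longrightarrow> 0 \<le> singular_values A ! i"
    and right_singular_basis: "\<exists>U\<in>carrier_mat n n. mat_adjoint U * U = 1\<^sub>m n \<and>
      mat_adjoint (A * U) * (A * U) = mat_diag n (\<lambda>i. complex_of_real ((singular_values A ! i)\<^sup>2))"
proof -
  note Ac = mat_adjoint_carrier[OF A]
  define G where "G = mat_adjoint A * A"
  have G: "G \<in> carrier_mat n n" unfolding G_def using A Ac by auto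
  have Gh: "mat_adjoint G = G" unfolding G_def mat_adjoint_mult[OF Ac A] by simp
  obtain es0 where es0: "char_poly G = (\<Prod>e\<leftarrow>es0. [:- e, 1:])" "length es0 = n"
    using char_poly_factorized[OF G] by blast
  define f where "f = (\<lambda>z. sqrt (Re z))"
  define es where "es = rev (sort_key f es0)"
  have len: "length es = n" unfolding es_def by (simp add: es0)
  have cp: "char_poly G = (\<Prod>e\<leftarrow>es. [:- e, 1:])"
    unfolding es0 es_def by (simp flip: prod_mset_prod_list)
  have "proots (\<Prod>e\<leftarrow>es. [:- e, 1:]) = mset es" for es :: "complex list"
  proof (induction es)
    case (Cons e es)
    have "(\<Prod>e\<leftarrow>es. [:- e, 1:]) \<noteq> 0" by (auto simp: prod_list_zero_iff)
    then have "proots ([:- e, 1:] * (\<Prod>e\<leftarrow>es. [:- e, 1:])) = add_mset e (mset es)"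
      by (subst proots_mult) (simp_all add: Cons.IH)
    then show ?case by (simp only: list.map prod_list.Cons mset.simps)
  qed simp
  then have "proots (char_poly G) = mset es0" unfolding es0(1) .
  then have sv: "singular_values A = rev (sort (map f es0))"
    by (simp add: singular_values_def G_def f_def flip: mset_map)
  have "map f (sort_key f es0) = sort (map f es0)"
    by (rule properties_for_sort[symmetric]) simp_all
  then have "rev (map f (sort_key f es0)) = rev (sort (map f es0))" by (simp only:)
  then have sv': "singular_values A = map f es"
    unfolding sv es_def by (simp only: rev_map)
  obtain U where U: "U \<in> carrier_mat n n" "mat_adjoint U * U = 1\<^sub>m n"
    and Ud: "mat_adjoint U * G * U = mat_diag n (\<lambda>i. es ! i)"
    using hermitian_diagonalization[OF G Gh cp] .
  have AU: "A * U \<in> carrier_mat n n" using A U(1) by simp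
  have "mat_adjoint (A * U) * (A * U) = mat_adjoint U * (mat_adjoint A * (A * U))"
    unfolding mat_adjoint_mult[OF A U(1)]
    by (rule assoc_mult_mat[OF mat_adjoint_carrier[OF U(1)] Ac AU])
  also have "\<dots> = mat_adjoint U * G * U"
    unfolding G_def assoc_mult_mat[OF mat_adjoint_carrier[OF U(1)] G[unfolded G_def] U(1)]
      assoc_mult_mat[OF Ac A U(1)] ..
  finally have "mat_adjoint (A * U) * (A * U) = mat_adjoint U * G * U" .
  then have AUd: "mat_adjoint (A * U) * (A * U) = mat_diag n (\<lambda>i. es ! i)" using Ud by simp
  have esr: "es ! i = of_real ((singular_values A ! i)\<^sup>2)" if i: "i < n" for i
  proof -
    have "es ! i = (mat_adjoint (A * U) * (A * U)) $$ (i, i)"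
      unfolding AUd using i by (simp add: mat_diag_def)
    also have "\<dots> = (\<Sum>k = 0..<n. cnj ((A * U) $$ (k, i)) * (A * U) $$ (k, i))"
      using mat_adjoint_mult_index[of i "A * U" i "A * U", unfolded carrier_matD[OF AU]] i by blast
    also have "\<dots> = of_real (\<Sum>k = 0..<n. (cmod ((A * U) $$ (k, i)))\<^sup>2)"
      by (simp add: complex_norm_square mult.commute del: of_real_power index_mult_mat(1))
    finally have "es ! i = of_real (\<Sum>k = 0..<n. (cmod ((A * U) $$ (k, i)))\<^sup>2)" .
    moreover have "(\<Sum>k = 0..<n. (cmod ((A * U) $$ (k, i)))\<^sup>2) \<ge> 0" by (simp add: sum_nonneg)
    ultimately show ?thesis using i len by (simp add: sv' f_def del: index_mult_mat(1))
  qed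
  have "mat_adjoint (A * U) * (A * U) = mat_diag n (\<lambda>i. complex_of_real ((singular_values A ! i)\<^sup>2))"
    unfolding AUd using esr by (intro eq_matI) (auto simp: mat_diag_def)
  then show "\<exists>U\<in>carrier_mat n n. mat_adjoint U * U = 1\<^sub>m n \<and>
      mat_adjoint (A * U) * (A * U) = mat_diag n (\<lambda>i. complex_of_real ((singular_values A ! i)\<^sup>2))"
    using U by blast
  have "sorted (sort (map f es0))" by simp
  then show "sorted_wrt (\<ge>) (singular_values A)" unfolding sv sorted_wrt_rev by simp
  show "length (singular_values A) = n" by (simp add: sv' len)
  show "0 \<le> singular_values A ! i" if i: "i < n" for i
  proof -
    have "0 \<le> Re (es ! i)" using esr[OF i] by simp
    then show ?thesis using i len by (simp add: sv' f_def)
  qed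
qed

text \<open>Fewer equations than unknowns: \<open>i\<close> equations in the first \<open>i + 1\<close> unknowns. Filled up with a zero
  row, this is a square system of determinant zero.\<close>

lemma underdetermined_kernel:
  fixes M :: "'a :: field mat"
  assumes "i < n" "M \<in> carrier_mat i n"
  obtains c where "c \<in> carrier_vec n" "c \<noteq> 0\<^sub>v n" "M *\<^sub>v c = 0\<^sub>v i" "\<And>j. i < j \<Longrightarrow> j < n \<Longrightarrow> c $ j = 0"
proof -
  (* Row i of S is zero, so every permutation contributes a zero factor to the determinant. *)
  define S where "S = Matrix.mat (Suc i) (Suc i) (\<lambda>(p, q). if p < i then M $$ (p, q) else 0)"
  have S: "S \<in> carrier_mat (Suc i) (Suc i)" unfolding S_def by simp
  have "Determinant.det S = 0"
    unfolding det_def'[OF S]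
  proof (intro sum.neutral ballI)
    fix p assume "p \<in> {p. p permutes {0..<Suc i}}"
    then have "p i < Suc i" by (metis atLeastLessThan_iff lessI mem_Collect_eq permutes_in_image zero_le)
    then have "S $$ (i, p i) = 0" by (simp add: S_def)
    then show "signof p * (\<Prod>i = 0..<Suc i. S $$ (i, p i)) = 0" by simp
  qed
  then obtain v where v: "v \<in> carrier_vec (Suc i)" "v \<noteq> 0\<^sub>v (Suc i)" "S *\<^sub>v v = 0\<^sub>v (Suc i)"
    using det_0_iff_vec_prod_zero_field[OF S] by auto
  define c where "c = Matrix.vec n (\<lambda>j. if j \<le> i then v $ j else 0)"
  show thesis
  proof (rule that[of c])
    show "c \<in> carrier_vec n" by (simp add: c_def)
    show "c \<noteq> 0\<^sub>v n"
    proof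
      assume "c = 0\<^sub>v n"
      then have "v $ j = 0" if "j \<le> i" for j
        using that \<open>i < n\<close> index_vec[of j n "\<lambda>j. if j \<le> i then v $ j else 0", folded c_def] by simp
      then have "v = 0\<^sub>v (Suc i)" using v(1) by (intro eq_vecI) auto
      with v(2) show False by simp
    qed
    show "M *\<^sub>v c = 0\<^sub>v i"
    proof (rule eq_vecI)
      fix p assume p: "p < dim_vec (0\<^sub>v i :: 'a Matrix.vec)"
      have "(M *\<^sub>v c) $ p = (\<Sum>q = 0..<n. M $$ (p, q) * c $ q)"
        using p assms by (auto simp: scalar_prod_def c_def intro!: sum.cong)
      also have "\<dots> = (\<Sum>q = 0..<Suc i. M $$ (p, q) * v $ q)"
        using \<open>i < n\<close> by (intro sum.mono_neutral_cong_right) (auto simp: c_def)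
      also have "\<dots> = (S *\<^sub>v v) $ p"
        using p v(1) by (auto simp: S_def scalar_prod_def intro!: sum.cong)
      finally show "(M *\<^sub>v c) $ p = 0\<^sub>v i $ p" using p by (simp add: v(3))
    qed (use assms in auto)
    show "c $ j = 0" if "i < j" "j < n" for j using that by (simp add: c_def)
  qed
qed

text \<open>One half of the Courant-Fischer principle, with positions counted from \<open>0\<close>. The span of the
  first \<open>i + 1\<close> right singular vectors meets the kernel of any \<open>i\<close> linear conditions \<open>Z\<close>, and on
  that span \<open>A\<close> stretches every vector at least by its singular value in position \<open>i\<close>. Different
  choices of \<open>Z\<close> give Weyl's inequality and the vanishing of singular values beyond the rank.\<close>

lemma singular_value_le_on_kernel:
  assumes A: "A \<in> carrier_mat n n" and i: "i < n" and Z: "Z \<in> carrier_mat i n"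
  obtains x where "x \<in> carrier_vec n" "0 < vec_norm2 x" "Z *\<^sub>v x = 0\<^sub>v i"
    "singular_values A ! i * vec_norm2 x \<le> vec_norm2 (A *\<^sub>v x)"
proof -
  obtain U where U: "U \<in> carrier_mat n n" "mat_adjoint U * U = 1\<^sub>m n"
    "mat_adjoint (A * U) * (A * U) = mat_diag n (\<lambda>i. complex_of_real ((singular_values A ! i)\<^sup>2))"
    using right_singular_basis[OF A] by blast
  note sv = singular_values_sorted[OF A] length_singular_values[OF A] singular_values_nonneg[OF A]
  have "Z * U \<in> carrier_mat i n" using Z U by simp
  from underdetermined_kernel[OF i this] obtain c where c: "c \<in> carrier_vec n" "c \<noteq> 0\<^sub>v n"
    and ZUc: "(Z * U) *\<^sub>v c = 0\<^sub>v i" and c0: "\<And>j. i < j \<Longrightarrow> j < n \<Longrightarrow> c $ j = 0" by blast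
  define x where "x = U *\<^sub>v c"
  have x: "x \<in> carrier_vec n" unfolding x_def using U c by simp
  have nx: "(vec_norm2 x)\<^sup>2 = (\<Sum>j = 0..<n. (cmod (c $ j))\<^sup>2)"
    unfolding x_def using vec_norm2_orthogonal_columns[OF U(1) c(1), of "\<lambda>_. 1"] U(2) by simp
  have "A *\<^sub>v x = (A * U) *\<^sub>v c" unfolding x_def using A U(1) c(1) by simp
  then have nAx: "(vec_norm2 (A *\<^sub>v x))\<^sup>2 = (\<Sum>j = 0..<n. (singular_values A ! j)\<^sup>2 * (cmod (c $ j))\<^sup>2)"
    using vec_norm2_orthogonal_columns[OF mult_carrier_mat[OF A U(1)] c(1) U(3)] by simp
  have "(singular_values A ! i * vec_norm2 x)\<^sup>2
      = (\<Sum>j = 0..<n. (singular_values A ! i)\<^sup>2 * (cmod (c $ j))\<^sup>2)"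
    by (simp add: power_mult_distrib nx sum_distrib_left)
  also have "\<dots> \<le> (vec_norm2 (A *\<^sub>v x))\<^sup>2"
    unfolding nAx
  proof (rule sum_mono)
    fix j assume j: "j \<in> {0..<n}"
    show "(singular_values A ! i)\<^sup>2 * (cmod (c $ j))\<^sup>2 \<le> (singular_values A ! j)\<^sup>2 * (cmod (c $ j))\<^sup>2"
    proof (cases "j \<le> i")
      case True
      then have "singular_values A ! i \<le> singular_values A ! j"
        using sv(1,2) i by (cases "j = i") (auto simp: sorted_wrt_iff_nth_less)
      then show ?thesis using sv(3)[OF i] by (intro mult_right_mono power_mono) auto
    next
      case False
      then show ?thesis using c0[of j] j by simp
    qed
  qed
  finally have le: "singular_values A ! i * vec_norm2 x \<le> vec_norm2 (A *\<^sub>v x)"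
    by (rule power2_le_imp_le) simp
  obtain j where "j < n" "c $ j \<noteq> 0"
    using c by (metis carrier_vecD eq_vecI index_zero_vec(1) index_zero_vec(2))
  then have "0 < (\<Sum>j = 0..<n. (cmod (c $ j))\<^sup>2)" by (intro sum_pos2[of _ j]) auto
  then have "0 < vec_norm2 x" unfolding nx[symmetric] by (simp add: order_less_le)
  moreover have "Z *\<^sub>v x = 0\<^sub>v i" using ZUc Z U(1) c(1) unfolding x_def by simp
  ultimately show thesis using that x le by blast
qed

text \<open>Take for \<open>Z\<close> the coordinates along the first \<open>i\<close> right singular vectors of \<open>B\<close>. On their common
  kernel \<open>B\<close> stretches vectors at most by its singular value in position \<open>i\<close>, so a vector found by
  \<open>singular_value_le_on_kernel\<close> compares the two matrices. The Frobenius norm stands in for the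
  operator norm.\<close>

lemma weyl_singular_values:
  assumes A: "A \<in> carrier_mat n n" and B: "B \<in> carrier_mat n n" and i: "i < n"
  shows "singular_values A ! i \<le> singular_values B ! i + frobenius_norm (A - B)"
proof -
  obtain V where V: "V \<in> carrier_mat n n" "mat_adjoint V * V = 1\<^sub>m n"
    "mat_adjoint (B * V) * (B * V) = mat_diag n (\<lambda>i. complex_of_real ((singular_values B ! i)\<^sup>2))"
    using right_singular_basis[OF B] by blast
  note sv = singular_values_sorted[OF B] length_singular_values[OF B] singular_values_nonneg[OF B]
  note Vc = mat_adjoint_carrier[OF V(1)]
  define Z where "Z = Matrix.mat i n (\<lambda>(p, q). mat_adjoint V $$ (p, q))"
  have Z: "Z \<in> carrier_mat i n" by (simp add: Z_def)
  obtain x where x: "x \<in> carrier_vec n" "0 < vec_norm2 x" "Z *\<^sub>v x = 0\<^sub>v i"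
    and le: "singular_values A ! i * vec_norm2 x \<le> vec_norm2 (A *\<^sub>v x)"
    using singular_value_le_on_kernel[OF A i Z] .
  define d where "d = mat_adjoint V *\<^sub>v x"
  have d: "d \<in> carrier_vec n" unfolding d_def using Vc x(1) by simp
  have d0: "d $ j = 0" if j: "j < i" for j
  proof -
    have "d $ j = (Z *\<^sub>v x) $ j"
      unfolding d_def Z_def using j i Vc x(1) V(1) by (auto simp: scalar_prod_def intro!: sum.cong)
    then show ?thesis using x(3) j by simp
  qed
  have "V * mat_adjoint V = 1\<^sub>m n" using mat_mult_left_right_inverse[OF Vc V(1,2)] .
  then have xd: "x = V *\<^sub>v d"
    unfolding d_def using V(1) Vc x(1) by (metis assoc_mult_mat_vec one_mult_mat_vec)
  have nx: "(vec_norm2 x)\<^sup>2 = (\<Sum>j = 0..<n. (cmod (d $ j))\<^sup>2)"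
    unfolding xd using vec_norm2_orthogonal_columns[OF V(1) d, of "\<lambda>_. 1"] V(2) by simp
  have "B *\<^sub>v x = (B * V) *\<^sub>v d" unfolding xd using B V(1) d by simp
  then have "(vec_norm2 (B *\<^sub>v x))\<^sup>2 = (\<Sum>j = 0..<n. (singular_values B ! j)\<^sup>2 * (cmod (d $ j))\<^sup>2)"
    using vec_norm2_orthogonal_columns[OF mult_carrier_mat[OF B V(1)] d V(3)] by simp
  also have "\<dots> \<le> (\<Sum>j = 0..<n. (singular_values B ! i)\<^sup>2 * (cmod (d $ j))\<^sup>2)"
  proof (rule sum_mono)
    fix j assume j: "j \<in> {0..<n}"
    show "(singular_values B ! j)\<^sup>2 * (cmod (d $ j))\<^sup>2 \<le> (singular_values B ! i)\<^sup>2 * (cmod (d $ j))\<^sup>2"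
    proof (cases "i \<le> j")
      case True
      then have "singular_values B ! j \<le> singular_values B ! i"
        using sv(1,2) j by (cases "j = i") (auto simp: sorted_wrt_iff_nth_less)
      then show ?thesis using sv(3)[of j] j by (intro mult_right_mono power_mono) auto
    qed (simp add: d0)
  qed
  also have "\<dots> = (singular_values B ! i * vec_norm2 x)\<^sup>2"
    by (simp add: power_mult_distrib nx sum_distrib_left)
  finally have Bx: "vec_norm2 (B *\<^sub>v x) \<le> singular_values B ! i * vec_norm2 x"
    by (rule power2_le_imp_le) (use sv(3)[OF i] in simp)
  have AB: "A - B \<in> carrier_mat n n" using B by (rule minus_carrier_mat)
  have "A *\<^sub>v x = B *\<^sub>v x + (A - B) *\<^sub>v x"
    using A B x(1) by (intro eq_vecI) (auto simp: minus_mult_distrib_mat_vec)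
  then have "vec_norm2 (A *\<^sub>v x) \<le> vec_norm2 (B *\<^sub>v x) + vec_norm2 ((A - B) *\<^sub>v x)"
    using vec_norm2_add[of "B *\<^sub>v x" n "(A - B) *\<^sub>v x"] B AB x(1) by simp
  also have "\<dots> \<le> singular_values B ! i * vec_norm2 x + frobenius_norm (A - B) * vec_norm2 x"
    using Bx vec_norm2_mult_mat_vec_le[OF AB x(1)] by linarith
  finally have "singular_values A ! i * vec_norm2 x
      \<le> (singular_values B ! i + frobenius_norm (A - B)) * vec_norm2 x"
    using le by (simp add: algebra_simps)
  then show ?thesis using x(2) by simp
qed

text \<open>A product through dimension \<open>p\<close> has rank at most \<open>p\<close>: it vanishes on the kernel of \<open>Q\<close>.\<close>

lemma singular_value_zero_of_factorization:
  assumes P: "P \<in> carrier_mat n p" and Q: "Q \<in> carrier_mat p n" and p: "p < n"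
  shows "singular_values (P * Q) ! p = 0"
proof -
  have PQ: "P * Q \<in> carrier_mat n n" using P Q by simp
  obtain x where x: "x \<in> carrier_vec n" "0 < vec_norm2 x" "Q *\<^sub>v x = 0\<^sub>v p"
    and le: "singular_values (P * Q) ! p * vec_norm2 x \<le> vec_norm2 ((P * Q) *\<^sub>v x)"
    using singular_value_le_on_kernel[OF PQ p Q] .
  have "(P * Q) *\<^sub>v x = 0\<^sub>v n" using P Q x(1,3) by auto
  then have "vec_norm2 ((P * Q) *\<^sub>v x) = 0" by (simp add: vec_norm2_def L2_set_def)
  with le x(2) have "singular_values (P * Q) ! p \<le> 0"
    by (simp add: mult_le_0_iff)
  moreover have "0 \<le> singular_values (P * Q) ! p"
    using PQ p by (rule singular_values_nonneg)
  ultimately show ?thesis by simp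
qed

section \<open>Weighted least-squares extrapolation\<close>

lemma minv_mult:
  fixes A :: "real mat"
  assumes "A \<in> carrier_mat n n" "Determinant.det A \<noteq> 0"
  shows "minv A \<in> carrier_mat n n" "minv A * A = 1\<^sub>m n" "A * minv A = 1\<^sub>m n"
proof -
  have "A \<in> Units (ring_mat TYPE(real) n n)" using det_non_zero_imp_unit[OF assms] .
  then obtain B where "mat_inverse A = Some B"
    using mat_inverse(1)[OF assms(1), where b = n] by (cases "mat_inverse A") auto
  with mat_inverse(2)[OF assms(1) this]
  show "minv A \<in> carrier_mat n n" "minv A * A = 1\<^sub>m n" "A * minv A = 1\<^sub>m n" by auto
qed

lemma minv_mat_diag:
  assumes "\<And>l. l < K \<Longrightarrow> d l \<noteq> 0"
  shows "minv (mat_diag K d) = mat_diag K (\<lambda>l. 1 / d l)"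
proof -
  have I: "mat_diag K d * mat_diag K (\<lambda>l. 1 / d l) = 1\<^sub>m K"
    unfolding mat_diag_diag using assms by (intro eq_matI) (auto simp: mat_diag_def)
  have "Determinant.det (mat_diag K d) * Determinant.det (mat_diag K (\<lambda>l. 1 / d l)) = 1"
    unfolding det_mult[OF mat_diag_dim mat_diag_dim, symmetric] I by simp
  then have "Determinant.det (mat_diag K d) \<noteq> 0" by auto
  note M = minv_mult[OF mat_diag_dim this]
  have "minv (mat_diag K d) = minv (mat_diag K d) * (mat_diag K d * mat_diag K (\<lambda>l. 1 / d l))"
    unfolding I using M(1) by simp
  also have "\<dots> = mat_diag K (\<lambda>l. 1 / d l)"
    unfolding assoc_mult_mat[OF M(1) mat_diag_dim mat_diag_dim, symmetric] M(2)
    by (rule left_mult_one_mat[OF mat_diag_dim])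
  finally show ?thesis .
qed

text \<open>Positive variances and two distinct nodes make the normal matrix \<open>X\<^sup>T \<Sigma>\<^sup>-\<^sup>1 X\<close> invertible,
  and the estimator is defined through its inverse.\<close>

locale gls_design =
  fixes K :: nat and x \<sigma>2 :: "nat \<Rightarrow> real"
  assumes var_pos: "l < K \<Longrightarrow> 0 < \<sigma>2 l"
    and two_points: "\<exists>i<K. \<exists>j<K. x i \<noteq> x j"
begin

definition normal_mat :: "real mat" where
  "normal_mat = transpose_mat (design_mat K x) * minv (mat_diag K \<sigma>2) * design_mat K x"

definition weighted_design :: "real mat" where
  "weighted_design = transpose_mat (design_mat K x) * minv (mat_diag K \<sigma>2)"

lemma design_carrier: "design_mat K x \<in> carrier_mat K 2"
  by (simp add: design_mat_def)

lemma weighted_design_eq: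
  "weighted_design = Matrix.mat 2 K (\<lambda>(j, l). (if j = 0 then 1 else x l) / \<sigma>2 l)"
proof -
  have "minv (mat_diag K \<sigma>2) = mat_diag K (\<lambda>l. 1 / \<sigma>2 l)"
    by (rule minv_mat_diag) (use var_pos in force)
  then show ?thesis
    unfolding weighted_design_def
    by (simp only: mat_diag_mult_right[of _ 2] transpose_carrier_mat design_carrier)
      (auto simp: design_mat_def)
qed

lemma normal_mat_carrier: "normal_mat \<in> carrier_mat 2 2"
  using design_carrier unfolding normal_mat_def weighted_design_def[symmetric] weighted_design_eq
  by auto

text \<open>For \<open>v\<close> in the kernel, \<open>v\<^sup>T (X\<^sup>T \<Sigma>\<^sup>-\<^sup>1 X) v\<close> is the weighted sum of squares of the affine function
  \<open>u\<close> with coefficients \<open>v\<close>. So \<open>u\<close> vanishes at all nodes, and an affine function with two zeros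
  is zero.\<close>

lemma normal_mat_det: "Determinant.det normal_mat \<noteq> 0"
proof
  assume "Determinant.det normal_mat = 0"
  then obtain v where v: "v \<in> carrier_vec 2" "v \<noteq> 0\<^sub>v 2" "normal_mat *\<^sub>v v = 0\<^sub>v 2"
    using det_0_iff_vec_prod_zero_field[OF normal_mat_carrier] by auto
  define u where "u l = v $ 0 + x l * v $ 1" for l
  have W: "weighted_design \<in> carrier_mat 2 K" unfolding weighted_design_eq by simp
  have "design_mat K x *\<^sub>v v = Matrix.vec K u"
    using v(1) by (intro eq_vecI) (auto simp: design_mat_def scalar_prod_def u_def numeral_2_eq_2)
  then have *: "normal_mat *\<^sub>v v = weighted_design *\<^sub>v Matrix.vec K u"
    unfolding normal_mat_def weighted_design_def[symmetric] using W design_carrier v(1) by simp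
  have e: "(\<Sum>l = 0..<K. u l / \<sigma>2 l) = 0" "(\<Sum>l = 0..<K. x l * u l / \<sigma>2 l) = 0"
    using arg_cong[OF v(3), of "\<lambda>w. w $ 0"] arg_cong[OF v(3), of "\<lambda>w. w $ 1"]
    unfolding * by (simp_all add: weighted_design_eq scalar_prod_def)
  have "(\<Sum>l = 0..<K. (u l)\<^sup>2 / \<sigma>2 l)
      = v $ 0 * (\<Sum>l = 0..<K. u l / \<sigma>2 l) + v $ 1 * (\<Sum>l = 0..<K. x l * u l / \<sigma>2 l)"
    unfolding sum_distrib_left sum.distrib[symmetric]
    by (intro sum.cong refl) (simp add: u_def power2_eq_square add_divide_distrib algebra_simps)
  also have "\<dots> = 0" by (simp add: e)
  finally have "\<forall>l\<in>{0..<K}. (u l)\<^sup>2 / \<sigma>2 l = 0"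
    using var_pos by (subst (asm) sum_nonneg_eq_0_iff) (auto intro!: divide_nonneg_pos)
  then have u0: "u l = 0" if "l < K" for l using var_pos[OF that] that by force
  obtain i j where ij: "i < K" "j < K" "x i \<noteq> x j" using two_points by blast
  have "x i * v $ 1 = x j * v $ 1" using u0[OF ij(1)] u0[OF ij(2)] unfolding u_def by linarith
  then have v1: "v $ 1 = 0" using ij by simp
  then have "v $ 0 = 0" using u0[OF ij(1)] by (simp add: u_def)
  then have "v = 0\<^sub>v 2" using v1 v(1) by (intro eq_vecI) (auto simp: less_2_cases_iff)
  with v(2) show False by simp
qed

lemma cov_carrier: "gls_cov K x \<sigma>2 \<in> carrier_mat 2 2"
  and cov_mult: "gls_cov K x \<sigma>2 * normal_mat = 1\<^sub>m 2"
  using minv_mult[OF normal_mat_carrier normal_mat_det]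
  by (auto simp: gls_cov_def normal_mat_def)

lemma gls_weight_eq:
  assumes l: "l < K"
  shows "gls_weight K x \<sigma>2 $ l = (gls_cov K x \<sigma>2 * weighted_design) $$ (0, l)"
    and "gls_weight K x \<sigma>2 $ l = (gls_cov K x \<sigma>2 $$ (0, 0) + gls_cov K x \<sigma>2 $$ (0, 1) * x l) / \<sigma>2 l"
proof -
  have W: "weighted_design \<in> carrier_mat 2 K" unfolding weighted_design_eq by simp
  have D: "minv (mat_diag K \<sigma>2) \<in> carrier_mat K K"
    by (subst minv_mat_diag) (use var_pos in force, simp)
  have "gls_cov K x \<sigma>2 * transpose_mat (design_mat K x) * minv (mat_diag K \<sigma>2)
      = gls_cov K x \<sigma>2 * weighted_design"
    unfolding weighted_design_def using cov_carrier design_carrier D by simp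
  then show "gls_weight K x \<sigma>2 $ l = (gls_cov K x \<sigma>2 * weighted_design) $$ (0, l)"
    using l cov_carrier W by (simp add: gls_weight_def)
  then show "gls_weight K x \<sigma>2 $ l
      = (gls_cov K x \<sigma>2 $$ (0, 0) + gls_cov K x \<sigma>2 $$ (0, 1) * x l) / \<sigma>2 l"
    using l cov_carrier W
    by (simp add: scalar_prod_def weighted_design_eq numeral_2_eq_2 add_divide_distrib)
qed

text \<open>This is \<open>w\<^sup>T X = e\<^sub>1\<^sup>T\<close>, read off the two columns of \<open>X\<close>: the estimator reproduces the constant
  term and annihilates the slope.\<close>

lemma gls_unbiased:
  "(\<Sum>l<K. gls_weight K x \<sigma>2 $ l) = 1"
  "(\<Sum>l<K. gls_weight K x \<sigma>2 $ l * x l) = 0"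
proof -
  have W: "weighted_design \<in> carrier_mat 2 K" unfolding weighted_design_eq by simp
  have I: "(gls_cov K x \<sigma>2 * weighted_design) * design_mat K x = 1\<^sub>m 2"
    using cov_mult cov_carrier W design_carrier
    by (simp add: normal_mat_def weighted_design_def[symmetric])
  have CW: "gls_cov K x \<sigma>2 * weighted_design \<in> carrier_mat 2 K" using cov_carrier W by simp
  have "(\<Sum>l<K. gls_weight K x \<sigma>2 $ l * design_mat K x $$ (l, j))
      = ((gls_cov K x \<sigma>2 * weighted_design) * design_mat K x) $$ (0, j)" if "j < 2" for j
  proof -
    have dims: "dim_row (gls_cov K x \<sigma>2 * weighted_design) = 2"
      "dim_col (gls_cov K x \<sigma>2 * weighted_design) = K"
      "dim_row (design_mat K x) = K" "dim_col (design_mat K x) = 2"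
      using CW design_carrier by auto
    show ?thesis
      using that dims
      by (subst index_mult_mat(1)) (auto simp: scalar_prod_def gls_weight_eq(1) lessThan_atLeast0
          simp del: index_mult_mat)
  qed
  from this[of 0] this[of 1] show "(\<Sum>l<K. gls_weight K x \<sigma>2 $ l) = 1"
    "(\<Sum>l<K. gls_weight K x \<sigma>2 $ l * x l) = 0"
    unfolding I by (simp_all add: design_mat_def)
qed

text \<open>By the explicit form of the weights, \<open>w\<^sub>l \<sigma>\<^sub>l\<^sup>2\<close> is affine in \<open>x\<^sub>l\<close>; summing it against \<open>w\<^sub>l\<close>
  and using \<open>gls_unbiased\<close> leaves the constant coefficient, which is the upper left entry of
  \<open>(X\<^sup>T \<Sigma>\<^sup>-\<^sup>1 X)\<^sup>-\<^sup>1\<close>.\<close>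

lemma gls_var_eq: "gls_var K x \<sigma>2 = (\<Sum>l<K. (gls_weight K x \<sigma>2 $ l)\<^sup>2 * \<sigma>2 l)"
proof -
  let ?w = "\<lambda>l. gls_weight K x \<sigma>2 $ l" and ?C = "gls_cov K x \<sigma>2"
  have "(\<Sum>l<K. (?w l)\<^sup>2 * \<sigma>2 l) = (\<Sum>l<K. ?C $$ (0, 0) * ?w l + ?C $$ (0, 1) * (?w l * x l))"
  proof (intro sum.cong refl)
    fix l assume "l \<in> {..<K}"
    then have "l < K" by simp
    then have "?w l * \<sigma>2 l = ?C $$ (0, 0) + ?C $$ (0, 1) * x l"
      using var_pos[of l] by (simp add: gls_weight_eq(2))
    then show "(?w l)\<^sup>2 * \<sigma>2 l = ?C $$ (0, 0) * ?w l + ?C $$ (0, 1) * (?w l * x l)"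
      by (simp add: power2_eq_square mult.assoc) (simp add: algebra_simps)
  qed
  also have "\<dots> = ?C $$ (0, 0) * (\<Sum>l<K. ?w l) + ?C $$ (0, 1) * (\<Sum>l<K. ?w l * x l)"
    by (simp only: sum.distrib sum_distrib_left)
  also have "\<dots> = ?C $$ (0, 0)" by (simp add: gls_unbiased)
  also have "\<dots> = gls_var K x \<sigma>2"
    using cov_carrier by (simp add: gls_var_def)
  finally show ?thesis ..
qed

text \<open>The weights sum to \<open>1\<close>, so one of them is nonzero. Positivity makes the threshold in Markov's
  inequality positive.\<close>

lemma gls_var_pos: "0 < gls_var K x \<sigma>2"
proof -
  have "\<exists>l<K. gls_weight K x \<sigma>2 $ l \<noteq> 0"
    using gls_unbiased(1) by (metis lessThan_iff sum.neutral zero_neq_one)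
  then obtain l where "l < K" "gls_weight K x \<sigma>2 $ l \<noteq> 0" by blast
  then show ?thesis
    unfolding gls_var_eq using var_pos by (intro sum_pos2[of _ l]) (auto simp: less_imp_le)
qed

lemma gls_estimate_linear_model:
  assumes "\<And>l. l < K \<Longrightarrow> y l = \<mu> + b * of_real (x l) + r l + \<epsilon> l"
  shows "gls_estimate K x \<sigma>2 y - \<mu>
    = (\<Sum>l<K. of_real (gls_weight K x \<sigma>2 $ l) * r l)
      + (\<Sum>l<K. of_real (gls_weight K x \<sigma>2 $ l) * \<epsilon> l)"
proof -
  let ?w = "\<lambda>l. gls_weight K x \<sigma>2 $ l"
  have "gls_estimate K x \<sigma>2 y = (\<Sum>l<K. \<mu> * of_real (?w l) + b * of_real (?w l * x l)
      + of_real (?w l) * r l + of_real (?w l) * \<epsilon> l)"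
    unfolding gls_estimate_def using assms by (intro sum.cong refl) (simp add: algebra_simps)
  also have "\<dots> = \<mu> * of_real (\<Sum>l<K. ?w l) + b * of_real (\<Sum>l<K. ?w l * x l)
      + (\<Sum>l<K. of_real (?w l) * r l) + (\<Sum>l<K. of_real (?w l) * \<epsilon> l)"
    by (simp only: sum.distrib sum_distrib_left of_real_sum)
  finally show ?thesis by (simp add: gls_unbiased)
qed

end

lemma det_bias_bound:
  assumes "\<And>l. l < K \<Longrightarrow> 0 \<le> x l" "0 \<le> C" "0 \<le> A"
    and r: "\<And>l. l < K \<Longrightarrow> cmod (r l) \<le> C * (x l)\<^sup>2 * A"
  shows "cmod (\<Sum>l<K. of_real (gls_weight K x \<sigma>2 $ l) * r l) \<le> det_bias K x \<sigma>2 C A"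
proof -
  let ?w = "\<lambda>l. gls_weight K x \<sigma>2 $ l" and ?X = "Max (x ` {..<K})"
  have "cmod (\<Sum>l<K. of_real (?w l) * r l) \<le> (\<Sum>l<K. \<bar>?w l\<bar> * (C * ?X\<^sup>2 * A))"
  proof (intro sum_norm_le)
    fix l assume "l \<in> {..<K}"
    then have l: "l < K" by simp
    have "x l \<le> ?X" using l by simp
    then have "C * (x l)\<^sup>2 * A \<le> C * ?X\<^sup>2 * A"
      using assms(1)[OF l] assms(2,3) by (intro mult_right_mono mult_left_mono power_mono) auto
    then have "cmod (r l) \<le> C * ?X\<^sup>2 * A" using r[OF l] by linarith
    then show "cmod (of_real (?w l) * r l) \<le> \<bar>?w l\<bar> * (C * ?X\<^sup>2 * A)"
      by (simp add: norm_mult mult_left_mono)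
  qed
  also have "\<dots> = det_bias K x \<sigma>2 C A"
    by (simp add: det_bias_def sum_distrib_right sum_distrib_left mult_ac)
  finally show ?thesis .
qed

section \<open>Second moments and Markov's inequality\<close>

text \<open>Expand the square into the products \<open>X\<^sub>i cnj X\<^sub>j\<close>. Off the diagonal they have mean zero, because
  \<open>X\<^sub>i\<close> and \<open>cnj X\<^sub>j\<close> are independent and centred.\<close>

lemma (in prob_space) variance_weighted_sum:
  fixes X :: "nat \<Rightarrow> 'a \<Rightarrow> complex" and w s :: "nat \<Rightarrow> real"
  assumes indep: "indep_vars (\<lambda>_. borel) X {..<K}"
    and sq: "\<And>l. l < K \<Longrightarrow> integrable M (\<lambda>\<omega>. (cmod (X l \<omega>))\<^sup>2)"
    and mean: "\<And>l. l < K \<Longrightarrow> (\<integral>\<omega>. X l \<omega> \<partial>M) = 0"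
    and var: "\<And>l. l < K \<Longrightarrow> (\<integral>\<omega>. (cmod (X l \<omega>))\<^sup>2 \<partial>M) = s l"
  shows "integrable M (\<lambda>\<omega>. (cmod (\<Sum>l<K. of_real (w l) * X l \<omega>))\<^sup>2)"
    and "(\<integral>\<omega>. (cmod (\<Sum>l<K. of_real (w l) * X l \<omega>))\<^sup>2 \<partial>M) = (\<Sum>l<K. (w l)\<^sup>2 * s l)"
proof -
  have meas [measurable]: "X l \<in> borel_measurable M" if "l < K" for l
    using indep that by (auto simp: indep_vars_def)
  have int: "integrable M (X l)" if l: "l < K" for l
  proof (rule Bochner_Integration.integrable_bound)
    show "integrable M (\<lambda>\<omega>. 1 + (cmod (X l \<omega>))\<^sup>2)" using sq[OF l] by simp
    have "z \<le> 1 + z\<^sup>2" for z :: real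
      using zero_le_power2[of "z - 1 / 2"] by (simp add: power2_eq_square algebra_simps)
    then show "AE \<omega> in M. norm (X l \<omega>) \<le> norm (1 + (cmod (X l \<omega>))\<^sup>2)" by simp
  qed (use meas l in simp)
  have prod: "integrable M (\<lambda>\<omega>. X i \<omega> * cnj (X j \<omega>)) \<and>
      (\<integral>\<omega>. X i \<omega> * cnj (X j \<omega>) \<partial>M) = (if i = j then of_real (s j) else 0)"
    if ij: "i < K" "j < K" for i j
  proof (cases "i = j")
    case True
    have "X j \<omega> * cnj (X j \<omega>) = complex_of_real ((cmod (X j \<omega>))\<^sup>2)" for \<omega>
      by (simp add: complex_norm_square del: of_real_power)
    then show ?thesis
      using True sq[OF ij(2)] var[OF ij(2)]
      by (simp del: of_real_power add: integral_complex_of_real)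
  next
    case False
    (* Conjugate the whole family except X i, so that one composition gives the required pair. *)
    have "indep_vars (\<lambda>_. borel) (\<lambda>l \<omega>. (if l = i then id else cnj) (X l \<omega>)) {..<K}"
      by (rule indep_vars_compose2[OF indep])
        (auto intro!: borel_measurable_continuous_onI continuous_intros)
    from indep_var_restrict[OF this, of "{i}" "{j}"] 
    have "indep_var (PiM {i} (\<lambda>_. borel)) (\<lambda>\<omega>. \<lambda>l\<in>{i}. (if l = i then id else cnj) (X l \<omega>))
       (PiM {j} (\<lambda>_. borel)) (\<lambda>\<omega>. \<lambda>l\<in>{j}. (if l = i then id else cnj) (X l \<omega>))"
      using False ij by auto
    from indep_var_compose[OF this, of "\<lambda>f. f i" borel "\<lambda>f. f j" borel]
    have "indep_var borel (X i) borel (\<lambda>\<omega>. cnj (X j \<omega>))"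
      using False by (simp add: comp_def)
    from indep_var_lebesgue_integral[OF this] indep_var_integrable[OF this]
    show ?thesis using int[OF ij(1)] int[OF ij(2)] mean[OF ij(1)] False by simp
  qed
  have expand: "(cmod (\<Sum>l<K. of_real (w l) * X l \<omega>))\<^sup>2
      = Re (\<Sum>i<K. \<Sum>j<K. of_real (w i * w j) * (X i \<omega> * cnj (X j \<omega>)))" for \<omega>
  proof -
    have "complex_of_real ((cmod (\<Sum>l<K. of_real (w l) * X l \<omega>))\<^sup>2)
        = (\<Sum>i<K. \<Sum>j<K. of_real (w i * w j) * (X i \<omega> * cnj (X j \<omega>)))"
      by (simp add: complex_norm_square sum_product mult_ac del: of_real_power)
    then show ?thesis by (metis Re_complex_of_real)
  qed
  have I: "integrable M (\<lambda>\<omega>. \<Sum>i<K. \<Sum>j<K. of_real (w i * w j) * (X i \<omega> * cnj (X j \<omega>)))"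
    using prod by (intro Bochner_Integration.integrable_sum integrable_mult_right) auto
  show "integrable M (\<lambda>\<omega>. (cmod (\<Sum>l<K. of_real (w l) * X l \<omega>))\<^sup>2)"
    unfolding expand using I by (rule integrable_Re)
  have "(\<integral>\<omega>. (\<Sum>i<K. \<Sum>j<K. of_real (w i * w j) * (X i \<omega> * cnj (X j \<omega>))) \<partial>M)
      = (\<Sum>i<K. \<Sum>j<K. of_real (w i * w j) * (if i = j then of_real (s j) else 0))"
    using prod by (subst Bochner_Integration.integral_sum, force intro!: Bochner_Integration.integrable_sum integrable_mult_right,
        intro sum.cong refl, subst Bochner_Integration.integral_sum, force, intro sum.cong refl) auto
  also have "\<dots> = of_real (\<Sum>l<K. (w l)\<^sup>2 * s l)"
    by (simp add: if_distrib[of "\<lambda>z. _ * z"] power2_eq_square cong: if_cong)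
  finally show "(\<integral>\<omega>. (cmod (\<Sum>l<K. of_real (w l) * X l \<omega>))\<^sup>2 \<partial>M) = (\<Sum>l<K. (w l)\<^sup>2 * s l)"
    unfolding expand using integral_Re[OF I] by simp
qed

text \<open>Markov's inequality bounds the probability of \<open>V / \<alpha> \<le> S\<close>, which contains the complement of the
  event \<open>S \<le> V / \<alpha>\<close>.\<close>

lemma (in prob_space) markov_event:
  fixes S :: "'a \<Rightarrow> real"
  assumes int: "integrable M S" and nn: "\<And>\<omega>. \<omega> \<in> space M \<Longrightarrow> 0 \<le> S \<omega>"
    and V: "(\<integral>\<omega>. S \<omega> \<partial>M) = V" "0 < V" and \<alpha>: "0 < \<alpha>"
  shows "{\<omega> \<in> space M. S \<omega> \<le> V / \<alpha>} \<in> events" "1 - \<alpha> \<le> prob {\<omega> \<in> space M. S \<omega> \<le> V / \<alpha>}"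
proof -
  have [measurable]: "S \<in> borel_measurable M" using int by simp
  show E: "{\<omega> \<in> space M. S \<omega> \<le> V / \<alpha>} \<in> events" by measurable
  have c: "0 < V / \<alpha>" using V \<alpha> by simp
  have "prob {\<omega> \<in> space M. V / \<alpha> \<le> S \<omega>} \<le> (\<integral>\<omega>. S \<omega> \<partial>M) / (V / \<alpha>)"
    by (rule integral_Markov_inequality_measure[OF int, of "{}"]) (use nn c in auto)
  also have "\<dots> = \<alpha>" using V \<alpha> by simp
  finally have le: "prob {\<omega> \<in> space M. V / \<alpha> \<le> S \<omega>} \<le> \<alpha>" .
  have "1 - prob {\<omega> \<in> space M. S \<omega> \<le> V / \<alpha>} = prob (space M - {\<omega> \<in> space M. S \<omega> \<le> V / \<alpha>})"
    using prob_compl[OF E] by simp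
  also have "\<dots> \<le> prob {\<omega> \<in> space M. V / \<alpha> \<le> S \<omega>}"
    by (intro finite_measure_mono) auto
  finally show "1 - \<alpha> \<le> prob {\<omega> \<in> space M. S \<omega> \<le> V / \<alpha>}" using le by simp
qed

section \<open>Hankel matrices\<close>

lemma card_antidiagonal:
  assumes "m \<le> 2 * J - 2" "0 < J"
  shows "card {p \<in> {0..<J} \<times> {0..<J}. fst p + snd p = m} = hankel_mult J m"
proof -
  (* The row index r determines the entry; both r and m - r have to stay below J. *)
  have "bij_betw (\<lambda>r. (r, m - r)) {m - (J - 1)..min m (J - 1)}
      {p \<in> {0..<J} \<times> {0..<J}. fst p + snd p = m}"
    using assms by (intro bij_betwI[where g = fst]) auto
  from bij_betw_same_card[OF this] show ?thesis
    using assms by (auto simp: hankel_mult_def)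
qed

lemma sum_hankel:
  fixes f :: "nat \<Rightarrow> real"
  assumes "0 < J"
  shows "(\<Sum>p\<in>{0..<J} \<times> {0..<J}. f (fst p + snd p)) = (\<Sum>m\<le>2 * J - 2. real (hankel_mult J m) * f m)"
proof -
  have "(\<Sum>p\<in>{0..<J} \<times> {0..<J}. f (fst p + snd p))
      = (\<Sum>m\<le>2 * J - 2. \<Sum>p\<in>{p \<in> {0..<J} \<times> {0..<J}. fst p + snd p = m}. f (fst p + snd p))"
    by (rule sum.group[symmetric]) auto
  also have "\<dots> = (\<Sum>m\<le>2 * J - 2. \<Sum>p\<in>{p \<in> {0..<J} \<times> {0..<J}. fst p + snd p = m}. f m)"
    by (intro sum.cong refl) auto
  also have "\<dots> = (\<Sum>m\<le>2 * J - 2. real (hankel_mult J m) * f m)"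
    using assms by (intro sum.cong refl) (simp add: card_antidiagonal)
  finally show ?thesis .
qed

text \<open>The Vandermonde factorization of a Hankel matrix of power sums; it shows that the rank is at most
  the number of nodes.\<close>

lemma hankel_factorization:
  fixes g z :: "nat \<Rightarrow> complex"
  shows "hankel_mat J (\<lambda>m. \<Sum>l<L. g l * z l ^ m)
    = Matrix.mat J L (\<lambda>(r, l). g l * z l ^ r) * Matrix.mat L J (\<lambda>(l, s). z l ^ s)"
  unfolding hankel_mat_def
  by (intro eq_matI) (auto simp: scalar_prod_def power_add mult_ac lessThan_atLeast0 intro!: sum.cong)

text \<open>An error in the moment of order \<open>m\<close> is repeated along a whole antidiagonal; this is where the
  multiplicities come from.\<close>

lemma frobenius_norm_hankel_diff:
  assumes "0 < J"
  shows "frobenius_norm (hankel_mat J f - hankel_mat J g)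
    = L2_set (\<lambda>m. sqrt (real (hankel_mult J m)) * cmod (f m - g m)) {..2 * J - 2}"
proof -
  have "(\<Sum>p\<in>{0..<J} \<times> {0..<J}. (cmod ((hankel_mat J f - hankel_mat J g) $$ p))\<^sup>2)
      = (\<Sum>p\<in>{0..<J} \<times> {0..<J}. (\<lambda>m. (cmod (f m - g m))\<^sup>2) (fst p + snd p))"
    by (intro sum.cong refl) (auto simp: hankel_mat_def)
  also have "\<dots> = (\<Sum>m\<le>2 * J - 2. real (hankel_mult J m) * (cmod (f m - g m))\<^sup>2)"
    by (rule sum_hankel[OF assms])
  finally show ?thesis
    by (simp add: frobenius_norm_def L2_set_def case_prod_unfold power_mult_distrib hankel_mat_def)
qed

text \<open>Minkowski's inequality in the weighted Euclidean norm separates bias \<open>b\<close> and noise \<open>\<eta>\<close>, so that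
  only the noise has to be controlled by an event.\<close>

lemma hankel_error_bound:
  assumes J: "0 < J" and \<alpha>: "0 < \<alpha>"
    and d: "\<And>m. m \<le> 2 * J - 2 \<Longrightarrow> cmod (f m - g m) \<le> b m + cmod (\<eta> m)"
    and \<eta>: "(\<Sum>m\<le>2 * J - 2. real (hankel_mult J m) * (cmod (\<eta> m))\<^sup>2)
      \<le> (\<Sum>m\<le>2 * J - 2. real (hankel_mult J m) * v m) / \<alpha>"
  shows "frobenius_norm (hankel_mat J f - hankel_mat J g) \<le> hankel_error_level J b v \<alpha>"
proof -
  let ?n = "\<lambda>m. sqrt (real (hankel_mult J m))"
  have "frobenius_norm (hankel_mat J f - hankel_mat J g)
      \<le> L2_set (\<lambda>m. ?n m * b m + ?n m * cmod (\<eta> m)) {..2 * J - 2}"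
    unfolding frobenius_norm_hankel_diff[OF J]
    using d by (intro L2_set_mono) (auto simp flip: distrib_left intro: mult_left_mono)
  also have "\<dots> \<le> L2_set (\<lambda>m. ?n m * b m) {..2 * J - 2} + L2_set (\<lambda>m. ?n m * cmod (\<eta> m)) {..2 * J - 2}"
    by (rule L2_set_triangle_ineq)
  also have "\<dots> \<le> hankel_error_level J b v \<alpha>"
    using \<eta> by (simp add: hankel_error_level_def L2_set_def power_mult_distrib)
  finally show ?thesis .
qed

section \<open>Detection of the number of interfaces\<close>

lemma card_singular_values_above:
  assumes sorted: "sorted_wrt (\<ge>) (singular_values A)" and len: "length (singular_values A) = n"
    and L: "1 \<le> L" "L < n"
    and above: "t < singular_values A ! (L - 1)" and below: "singular_values A ! L \<le> t"
  shows "card {i \<in> {1..n}. singular_value A i > t} = L"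
proof -
  have mono: "singular_values A ! j \<le> singular_values A ! i" if "i \<le> j" "j < n" for i j
    using sorted len that by (cases "i = j") (auto simp: sorted_wrt_iff_nth_less)
  have "{i \<in> {1..n}. singular_value A i > t} = {1..L}"
  proof (intro equalityI subsetI)
    fix i assume i: "i \<in> {i \<in> {1..n}. singular_value A i > t}"
    show "i \<in> {1..L}"
    proof (rule ccontr)
      assume "i \<notin> {1..L}"
      then have "singular_values A ! (i - 1) \<le> singular_values A ! L" using i by (intro mono) auto
      then show False using i below by (simp add: singular_value_def)
    qed
  next
    fix i assume i: "i \<in> {1..L}"
    then have "singular_values A ! (L - 1) \<le> singular_values A ! (i - 1)" using L by (intro mono) auto
    then show "i \<in> {i \<in> {1..n}. singular_value A i > t}"
      using i L above by (simp add: singular_value_def)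
  qed
  then show ?thesis by simp
qed

text \<open>The exact matrix has singular values \<open>0\<close> after the first \<open>L\<close>, so Weyl's inequality bounds those
  of the perturbed matrix by \<open>e\<close> there, whatever the gap is. Weyl's inequality with the two
  matrices exchanged keeps the first \<open>L\<close> at least \<open>\<sigma>\<^sub>L - e\<close>.\<close>

lemma hankel_rank_detection:
  fixes g z :: "nat \<Rightarrow> complex"
  assumes L: "1 \<le> L" "L < J"
    and \<mu>: "\<And>m. \<mu> m = (\<Sum>l<L. g l * z l ^ m)"
    and err: "frobenius_norm (hankel_mat J \<mu>' - hankel_mat J \<mu>) \<le> e"
  shows "singular_value (hankel_mat J \<mu>') (L + 1) \<le> e"
    and "e < t \<Longrightarrow> t < singular_value (hankel_mat J \<mu>) L - e
      \<Longrightarrow> card {i \<in> {1..J}. singular_value (hankel_mat J \<mu>') i > t} = L"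
proof -
  have H: "hankel_mat J f \<in> carrier_mat J J" for f by (simp add: hankel_mat_def)
  have sym: "frobenius_norm (hankel_mat J \<mu> - hankel_mat J \<mu>')
      = frobenius_norm (hankel_mat J \<mu>' - hankel_mat J \<mu>)"
    using L by (simp add: frobenius_norm_hankel_diff norm_minus_commute)
  have "\<mu> = (\<lambda>m. \<Sum>l<L. g l * z l ^ m)" using \<mu> by blast
  then have "singular_values (hankel_mat J \<mu>) ! L = 0"
    using L by (simp only: hankel_factorization) (rule singular_value_zero_of_factorization[of _ J], auto)
  then have below: "singular_values (hankel_mat J \<mu>') ! L \<le> e"
    using weyl_singular_values[OF H[of \<mu>'] H[of \<mu>] L(2)] err by simp
  then show "singular_value (hankel_mat J \<mu>') (L + 1) \<le> e" by (simp add: singular_value_def)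
  have "L - 1 < J" using L by simp
  from weyl_singular_values[OF H[of \<mu>] H[of \<mu>'] this]
  have above: "singular_value (hankel_mat J \<mu>) L - e \<le> singular_values (hankel_mat J \<mu>') ! (L - 1)"
    using err sym by (simp add: singular_value_def)
  have sv: "sorted_wrt (\<ge>) (singular_values (hankel_mat J \<mu>'))"
    "length (singular_values (hankel_mat J \<mu>')) = J"
    using singular_values_sorted length_singular_values H by blast+
  show "card {i \<in> {1..J}. singular_value (hankel_mat J \<mu>') i > t} = L"
    if "e < t" "t < singular_value (hankel_mat J \<mu>) L - e"
    using that above below by (intro card_singular_values_above[OF sv L]) auto
qed

theorem corollary3p8:
  fixes M :: "'w measure"
    and L J K :: nat
    and R :: "nat \<Rightarrow> real" and Rs :: real and \<beta> :: "nat \<Rightarrow> complex"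
    and k :: "nat \<Rightarrow> real"
    and r :: "nat \<Rightarrow> nat \<Rightarrow> complex" and C\<^sub>M :: real
    and \<epsilon> y :: "nat \<Rightarrow> nat \<Rightarrow> 'w \<Rightarrow> complex"
    and \<tau> :: "nat \<Rightarrow> nat \<Rightarrow> real"
    and \<alpha> :: real
  assumes "prob_space M"
    and "L \<ge> 1" and "J \<ge> L + 1"
    and "strict_mono_on {..<L} R" and "\<And>l. l < L \<Longrightarrow> 0 < R l \<and> R l \<le> Rs"
    and "\<And>l. l < L \<Longrightarrow> rad_gamma \<beta> R l \<noteq> 0"
    and "\<And>l. l < K \<Longrightarrow> k l > 0" and "\<exists>i<K. \<exists>j<K. k i \<noteq> k j"
    and remainder: "\<And>m l. m \<le> 2 * J - 2 \<Longrightarrow> l < K \<Longrightarrow>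
           cmod (r m l) \<le> C\<^sub>M * (scaled_freq Rs k l)\<^sup>2 * rad_abs_moment L \<beta> R Rs (m + 2)"
    and indep: "\<And>m. m \<le> 2 * J - 2 \<Longrightarrow>
           prob_space.indep_vars M (\<lambda>_. borel) (\<epsilon> m) {..<K}"
    and square_integrable: "\<And>m l. m \<le> 2 * J - 2 \<Longrightarrow> l < K \<Longrightarrow>
           integrable M (\<lambda>\<omega>. (cmod (\<epsilon> m l \<omega>))\<^sup>2)"
    and mean_zero: "\<And>m l. m \<le> 2 * J - 2 \<Longrightarrow> l < K \<Longrightarrow> (\<integral>\<omega>. \<epsilon> m l \<omega> \<partial>M) = 0"
    and variance: "\<And>m l. m \<le> 2 * J - 2 \<Longrightarrow> l < K \<Longrightarrow>
           (\<integral>\<omega>. (cmod (\<epsilon> m l \<omega>))\<^sup>2 \<partial>M) = (\<tau> m l)\<^sup>2 \<and> (\<tau> m l)\<^sup>2 > 0"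
    and data: "\<And>m l \<omega>. m \<le> 2 * J - 2 \<Longrightarrow> l < K \<Longrightarrow> \<omega> \<in> space M \<Longrightarrow>
           y m l \<omega> = rad_moment L \<beta> R Rs m
             + rad_slope L \<beta> R Rs m * of_real (scaled_freq Rs k l) + r m l + \<epsilon> m l \<omega>"
    and "0 < \<alpha>" and "\<alpha> < 1"
  shows
    "let x = scaled_freq Rs k;
         \<sigma>2 = (\<lambda>m l. (\<tau> m l)\<^sup>2);
         b = (\<lambda>m. det_bias K x (\<sigma>2 m) C\<^sub>M (rad_abs_moment L \<beta> R Rs (m + 2)));
         v = (\<lambda>m. gls_var K x (\<sigma>2 m));
         H = hankel_mat J (rad_moment L \<beta> R Rs);
         H\<^sub>e = (\<lambda>\<omega>. hankel_mat J (\<lambda>m. gls_estimate K x (\<sigma>2 m) (\<lambda>l. y m l \<omega>)));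
         s = singular_value H L;
         e = hankel_error_level J b v \<alpha>
     in \<exists>E \<in> sets M. Sigma_Algebra.measure M E \<ge> 1 - \<alpha> \<and>
          (\<forall>\<omega>\<in>E.
             (e < s / 2 \<longrightarrow>
               (\<forall>t. e < t \<and> t < s - e \<longrightarrow>
                  card {i \<in> {1..J}. singular_value (H\<^sub>e \<omega>) i > t} = L)) \<and>
             singular_value (H\<^sub>e \<omega>) (L + 1) \<le> e)"
proof -
  interpret prob_space M by fact
  let ?x = "scaled_freq Rs k" and ?\<sigma>2 = "\<lambda>m l. (\<tau> m l)\<^sup>2"
  define w where "w m l = gls_weight K ?x (?\<sigma>2 m) $ l" for m l
  define b where "b m = det_bias K ?x (?\<sigma>2 m) C\<^sub>M (rad_abs_moment L \<beta> R Rs (m + 2))" for m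
  define v where "v m = gls_var K ?x (?\<sigma>2 m)" for m
  define \<eta> where "\<eta> m \<omega> = (\<Sum>l<K. of_real (w m l) * \<epsilon> m l \<omega>)" for m \<omega>
  define \<mu>' where "\<mu>' \<omega> m = gls_estimate K ?x (?\<sigma>2 m) (\<lambda>l. y m l \<omega>)" for \<omega> m
  define S where "S \<omega> = (\<Sum>m\<le>2 * J - 2. real (hankel_mult J m) * (cmod (\<eta> m \<omega>))\<^sup>2)" for \<omega>
  define V where "V = (\<Sum>m\<le>2 * J - 2. real (hankel_mult J m) * v m)"
  have J: "0 < J" "L < J" using \<open>J \<ge> L + 1\<close> by auto
  have R: "0 < R l" "R l \<le> Rs" if "l < L" for l using assms(5)[OF that] by auto
  have Rs: "0 < Rs" using R[of 0] \<open>L \<ge> 1\<close> by simp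
  have x_pos: "0 < ?x l" if "l < K" for l
    using assms(7)[OF that] Rs by (simp add: scaled_freq_def)
  have A_pos: "0 < rad_abs_moment L \<beta> R Rs m" for m
    unfolding rad_abs_moment_def
  proof (rule sum_pos)
    fix l assume "l \<in> {..<L}"
    then have "0 < cmod (rad_gamma \<beta> R l)" "0 < rad_xi R Rs l"
      using R(1)[of l] Rs assms(6)[of l] by (auto simp: rad_xi_def)
    then show "0 < cmod (rad_gamma \<beta> R l) * rad_xi R Rs l ^ m" by simp
  qed (use \<open>L \<ge> 1\<close> in \<open>auto simp: lessThan_empty_iff\<close>)
  obtain i j where ij: "i < K" "j < K" "k i \<noteq> k j" using assms(8) by blast
  have "k i * Rs \<noteq> k j * Rs" using ij Rs by simp
  then have x_ij: "?x i \<noteq> ?x j"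
    using assms(7)[OF ij(1)] assms(7)[OF ij(2)] Rs unfolding scaled_freq_def
    by (subst power2_eq_iff_nonneg) auto
  (* A norm bounded by C\<^sub>M times a positive number forces the sign of C\<^sub>M. *)
  have C_nonneg: "0 \<le> C\<^sub>M"
  proof -
    have "0 \<le> C\<^sub>M * ((?x i)\<^sup>2 * rad_abs_moment L \<beta> R Rs (0 + 2))"
      using order_trans[OF norm_ge_zero remainder[of 0 i]] ij by (simp add: mult.assoc)
    moreover have "0 < (?x i)\<^sup>2 * rad_abs_moment L \<beta> R Rs (0 + 2)"
      using x_pos[OF ij(1)] A_pos by simp
    ultimately show ?thesis by (simp add: zero_le_mult_iff)
  qed
  have gls: "gls_design K ?x (?\<sigma>2 m)" if "m \<le> 2 * J - 2" for m
    using variance[OF that] x_ij ij by unfold_locales blast+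
  have err: "cmod (\<mu>' \<omega> m - rad_moment L \<beta> R Rs m) \<le> b m + cmod (\<eta> m \<omega>)"
    if m: "m \<le> 2 * J - 2" and \<omega>: "\<omega> \<in> space M" for m \<omega>
  proof -
    interpret gls_design K ?x "?\<sigma>2 m" by (rule gls[OF m])
    have "\<mu>' \<omega> m - rad_moment L \<beta> R Rs m = (\<Sum>l<K. of_real (w m l) * r m l) + \<eta> m \<omega>"
      unfolding \<mu>'_def \<eta>_def w_def
      by (rule gls_estimate_linear_model) (use data[OF m _ \<omega>] in blast)
    moreover have "cmod (\<Sum>l<K. of_real (w m l) * r m l) \<le> b m"
      unfolding w_def b_def
      by (rule det_bias_bound) (use x_pos C_nonneg A_pos remainder[OF m] in \<open>auto intro: less_imp_le\<close>)
    ultimately show ?thesis using norm_triangle_ineq[of "\<Sum>l<K. of_real (w m l) * r m l" "\<eta> m \<omega>"]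
      by simp
  qed
  have \<eta>: "integrable M (\<lambda>\<omega>. (cmod (\<eta> m \<omega>))\<^sup>2)" "(\<integral>\<omega>. (cmod (\<eta> m \<omega>))\<^sup>2 \<partial>M) = v m" "0 < v m"
    if m: "m \<le> 2 * J - 2" for m
  proof -
    interpret gls_design K ?x "?\<sigma>2 m" by (rule gls[OF m])
    have var: "(\<integral>\<omega>. (cmod (\<epsilon> m l \<omega>))\<^sup>2 \<partial>M) = (\<tau> m l)\<^sup>2" if "l < K" for l
      using variance[OF m that] by simp
    note * = variance_weighted_sum[OF indep[OF m] square_integrable[OF m] mean_zero[OF m] var]
    show "integrable M (\<lambda>\<omega>. (cmod (\<eta> m \<omega>))\<^sup>2)" unfolding \<eta>_def by (rule *(1))
    show "(\<integral>\<omega>. (cmod (\<eta> m \<omega>))\<^sup>2 \<partial>M) = v m"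
      unfolding \<eta>_def v_def gls_var_eq w_def by (rule *(2))
    show "0 < v m" unfolding v_def by (rule gls_var_pos)
  qed
  have mult_pos: "0 < hankel_mult J m" if "m \<le> 2 * J - 2" for m
    using that J by (auto simp: hankel_mult_def)
  have V_pos: "0 < V"
    unfolding V_def using mult_pos \<eta>(3) by (intro sum_pos) auto
  have S_int: "integrable M S"
    unfolding S_def using \<eta>(1) by (intro Bochner_Integration.integrable_sum integrable_mult_right) auto
  have S_V: "(\<integral>\<omega>. S \<omega> \<partial>M) = V"
    unfolding S_def V_def using \<eta>(1,2) by (subst Bochner_Integration.integral_sum) auto
  have S_nonneg: "0 \<le> S \<omega>" for \<omega> unfolding S_def by (intro sum_nonneg) simp
  (* The event controls only the total noise energy, so it serves all thresholds at once. *)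
  define E where "E = {\<omega> \<in> space M. S \<omega> \<le> V / \<alpha>}"
  have E: "E \<in> events" "1 - \<alpha> \<le> prob E"
    unfolding E_def using markov_event[OF S_int S_nonneg S_V V_pos \<open>0 < \<alpha>\<close>] by auto
  have main: "frobenius_norm (hankel_mat J (\<mu>' \<omega>) - hankel_mat J (rad_moment L \<beta> R Rs))
      \<le> hankel_error_level J b v \<alpha>" if "\<omega> \<in> E" for \<omega>
    using that err J(1) \<open>0 < \<alpha>\<close> unfolding E_def S_def V_def
    by (intro hankel_error_bound[where \<eta> = "\<lambda>m. \<eta> m \<omega>"]) auto
  have moment: "rad_moment L \<beta> R Rs m
      = (\<Sum>l<L. rad_gamma \<beta> R l * complex_of_real (rad_xi R Rs l) ^ m)" for m
    by (simp add: rad_moment_def)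
  note detect = hankel_rank_detection[OF \<open>L \<ge> 1\<close> J(2) moment main]
  show ?thesis
    unfolding Let_def b_def[symmetric] v_def[symmetric] \<mu>'_def[symmetric]
    using E detect by (intro bexI[of _ E]) auto
qed

end
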